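(* Let $X$ and $Y$ be Hermitian operators on a $d$-dimensional complex Hilbert space. Then $$\min_{\rho\in\mathcal{M}_d}\left(\Delta^2X_\rho+\Delta^2Y_\rho\right)=\min_{x,y\in\mathbb{R}}\lambda_{\min}\left(X^2+Y^2-2(xX+yY)+(x^2+y^2)\mathbb{1}\right).$$ The conditions for the minimum in $x,y$ on the right-hand side can be written as the following system of three polynomial equations in the three real variables $\lambda,x,y$: $$D=0,\qquad \partial_xD=0,\qquad \partial_yD=0,\qquad\text{where } D=\det\left(X^2+Y^2-2(xX+yY)+(x^2+y^2-\lambda)\mathbb{1}\right).$$ These three equations always have a common solution, and the polynomials defining the solutions can always be found by algorithms used to determine a Gröbner basis. Consequently there is a polynomial $R(\lambda)$ in the single variable $\lambda$, obtained from this system by eliminating $x$ and $y$, whose minimal real root for which the corresponding $x,y$ are real as well is the tight lower bound for the sum of variances: $$\min_{\rho\in\mathcal{M}_d}\left(\Delta^2X_\rho+\Delta^2Y_\rho\right)=\min\left\{c\in\mathbb{R}: R(c)=0,\ \text{with the corresponding } x,y \text{ real}\right\}.$$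
   Context: $\mathcal{M}_d=\{\rho:\rho^\dagger=\rho\ge 0,\ \mathrm{Tr}\,\rho=1\}$ is the set of density matrices (mixed states) of size $d$. For a Hermitian operator $F$ and $\rho\in\mathcal{M}_d$, $\langle F\rangle_\rho=\mathrm{Tr}(\rho F)$, and the variance is $\Delta^2F_\rho=\langle F^2\rangle_\rho-\langle F\rangle_\rho^2=\min_{x\in\mathbb{R}}\langle (F-x\mathbb{1})^2\rangle_\rho$. $\lambda_{\min}(F)$ denotes the smallest eigenvalue of $F$, and $\mathbb{1}$ is the identity operator. For a root $c$ of $R$, the "corresponding $x,y$" are values such that $(\lambda,x,y)=(c,x,y)$ solves the system $D=\partial_xD=\partial_yD=0$; they may in general be complex even if $c$ is real. *)

theory Defs
  imports "HOL-Analysis.Analysis" "HOL-Computational_Algebra.Polynomial"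
begin

definition is_min :: "real set \<Rightarrow> real \<Rightarrow> bool" where
  "is_min S m \<longleftrightarrow> m \<in> S \<and> (\<forall>s\<in>S. m \<le> s)"


section \<open>Operators and states on a finite-dimensional complex Hilbert space\<close>

definition conj_transpose :: "complex^'n^'n \<Rightarrow> complex^'n^'n" where
  "conj_transpose A = (\<chi> i j. cnj (A $ j $ i))"

definition hermitian :: "complex^'n^'n \<Rightarrow> bool" where
  "hermitian A \<longleftrightarrow> conj_transpose A = A"

definition cinner :: "complex^'n \<Rightarrow> complex^'n \<Rightarrow> complex" where
  "cinner u v = (\<Sum>i\<in>UNIV. cnj (u $ i) * v $ i)"

text \<open>For a Hermitian matrix the quadratic form below is real, so taking the real part loses nothing.\<close>

definition psd :: "complex^'n^'n \<Rightarrow> bool" where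
  "psd A \<longleftrightarrow> hermitian A \<and> (\<forall>v. 0 \<le> Re (cinner v (A *v v)))"

definition density_matrices :: "(complex^'n^'n) set" where
  "density_matrices = {\<rho>. psd \<rho> \<and> trace \<rho> = 1}"

text \<open>For Hermitian arguments the trace below is real.\<close>

definition expectation :: "complex^'n^'n \<Rightarrow> complex^'n^'n \<Rightarrow> real" where
  "expectation \<rho> F = Re (trace (\<rho> ** F))"

definition variance :: "complex^'n^'n \<Rightarrow> complex^'n^'n \<Rightarrow> real" where
  "variance \<rho> F = expectation \<rho> (F ** F) - (expectation \<rho> F)\<^sup>2"

definition eigenvalue :: "complex^'n^'n \<Rightarrow> complex \<Rightarrow> bool" where
  "eigenvalue A c \<longleftrightarrow> (\<exists>v. v \<noteq> 0 \<and> A *v v = c *s v)"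

text \<open>Only applied to Hermitian matrices, all of whose eigenvalues are real.\<close>

definition lambda_min :: "complex^'n^'n \<Rightarrow> real" where
  "lambda_min A = Min {c::real. eigenvalue A (of_real c)}"

definition shifted_op :: "complex^'n^'n \<Rightarrow> complex^'n^'n \<Rightarrow> real \<Rightarrow> real \<Rightarrow> complex^'n^'n" where
  "shifted_op X Y x y =
     X ** X + Y ** Y - 2 *\<^sub>R (x *\<^sub>R X + y *\<^sub>R Y) + (x\<^sup>2 + y\<^sup>2) *\<^sub>R mat 1"


section \<open>Polynomials in three variables\<close>

text \<open>
  The ring of complex polynomials in \<open>\<lambda>, x, y\<close> is represented by iterated univariate
  polynomials: the outermost variable is \<open>x\<close>, the middle one \<open>y\<close>, the innermost one \<open>\<lambda>\<close>.
\<close>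

type_synonym poly3 = "complex poly poly poly"

definition const3 :: "complex \<Rightarrow> poly3" where "const3 a = [:[:[:a:]:]:]"
definition var_x :: poly3 where "var_x = [:0, 1:]"
definition var_y :: poly3 where "var_y = [:[:0, 1:]:]"
definition var_lambda :: poly3 where "var_lambda = [:[:[:0, 1:]:]:]"

definition eval3 :: "poly3 \<Rightarrow> complex \<Rightarrow> complex \<Rightarrow> complex \<Rightarrow> complex" where
  "eval3 p c a b = poly (poly (poly p [:[:a:]:]) [:b:]) c"
    \<comment> \<open>the value at \<open>\<lambda> = c\<close>, \<open>x = a\<close>, \<open>y = b\<close>\<close>

definition deriv_x :: "poly3 \<Rightarrow> poly3" where "deriv_x p = pderiv p"
definition deriv_y :: "poly3 \<Rightarrow> poly3" where "deriv_y p = map_poly pderiv p"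

definition const_mat :: "complex^'n^'n \<Rightarrow> poly3^'n^'n" where
  "const_mat A = (\<chi> i j. const3 (A $ i $ j))"

definition D_poly :: "complex^'n^'n \<Rightarrow> complex^'n^'n \<Rightarrow> poly3" where
  "D_poly X Y = det (const_mat (X ** X + Y ** Y)
     - mat 2 ** (mat var_x ** const_mat X + mat var_y ** const_mat Y)
     + mat (var_x\<^sup>2 + var_y\<^sup>2 - var_lambda))"

definition system_polys :: "complex^'n^'n \<Rightarrow> complex^'n^'n \<Rightarrow> poly3 set" where
  "system_polys X Y = {D_poly X Y, deriv_x (D_poly X Y), deriv_y (D_poly X Y)}"

definition common_zero :: "poly3 set \<Rightarrow> complex \<Rightarrow> complex \<Rightarrow> complex \<Rightarrow> bool" where
  "common_zero G c a b \<longleftrightarrow> (\<forall>p\<in>G. eval3 p c a b = 0)"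


section \<open>Ideals, Groebner bases and Buchberger's algorithm\<close>

abbreviation ideal_gen :: "'a::comm_ring_1 set \<Rightarrow> 'a set" where
  "ideal_gen S \<equiv> module.span (*) S"

text \<open>
  A monomial \<open>x ^ i * y ^ j * \<lambda> ^ k\<close> is represented by its exponents \<open>(i, j, k)\<close>. The monomial
  order is the lexicographic one with \<open>x > y > \<lambda>\<close>, an elimination order for \<open>x\<close> and \<open>y\<close>; it is
  the order in which iterated leading coefficients find the leading term. On exponent triples,
  \<open>\<le>\<close>, \<open>-\<close> and \<open>sup\<close> are the componentwise operations of the library's product instances, hence
  divisibility, quotient and least common multiple of monomials.
\<close>

definition lead_exps :: "poly3 \<Rightarrow> nat \<times> nat \<times> nat" where
  "lead_exps p = (degree p, degree (lead_coeff p), degree (lead_coeff (lead_coeff p)))"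

definition lead_coeff3 :: "poly3 \<Rightarrow> complex" where
  "lead_coeff3 p = lead_coeff (lead_coeff (lead_coeff p))"

definition term3 :: "complex \<Rightarrow> nat \<times> nat \<times> nat \<Rightarrow> poly3" where
  "term3 a e = (case e of (i, j, k) \<Rightarrow> monom (monom (monom a k) j) i)"

definition lead_term :: "poly3 \<Rightarrow> poly3" where
  "lead_term p = term3 (lead_coeff3 p) (lead_exps p)"

definition groebner_basis :: "poly3 set \<Rightarrow> poly3 set \<Rightarrow> bool" where
  "groebner_basis G I \<longleftrightarrow>
     finite G \<and> G \<subseteq> I \<and> ideal_gen (lead_term ` G) = ideal_gen (lead_term ` I)"

definition s_poly :: "poly3 \<Rightarrow> poly3 \<Rightarrow> poly3" where
  "s_poly f g = (let m = sup (lead_exps f) (lead_exps g) in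
     term3 (1 / lead_coeff3 f) (m - lead_exps f) * f - term3 (1 / lead_coeff3 g) (m - lead_exps g) * g)"

definition reduces :: "poly3 set \<Rightarrow> poly3 \<Rightarrow> poly3 \<Rightarrow> bool" where
  "reduces G f f' \<longleftrightarrow> f \<noteq> 0 \<and> (\<exists>g\<in>G. g \<noteq> 0 \<and> lead_exps g \<le> lead_exps f \<and>
     f' = f - term3 (lead_coeff3 f / lead_coeff3 g) (lead_exps f - lead_exps g) * g)"

definition remainder_of :: "poly3 set \<Rightarrow> poly3 \<Rightarrow> poly3 \<Rightarrow> bool" where
  "remainder_of G f r \<longleftrightarrow> (reduces G)\<^sup>*\<^sup>* f r \<and> (\<nexists>r'. reduces G r r')"

text \<open>
  One step of Buchberger's algorithm, with arbitrary choice of the critical pair and of the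
  reductions: a nonzero remainder of an S-polynomial is added to the current set.
  The algorithm stops when no step is possible.
\<close>

definition buchberger_step :: "poly3 set \<Rightarrow> poly3 set \<Rightarrow> bool" where
  "buchberger_step G G' \<longleftrightarrow> (\<exists>f\<in>G. \<exists>g\<in>G. \<exists>r. f \<noteq> 0 \<and> g \<noteq> 0 \<and>
     remainder_of G (s_poly f g) r \<and> r \<noteq> 0 \<and> G' = insert r G)"

definition buchberger_terminates :: "poly3 set \<Rightarrow> bool" where
  "buchberger_terminates F \<longleftrightarrow> (\<nexists>s. s 0 = F \<and> (\<forall>n::nat. buchberger_step (s n) (s (Suc n))))"

definition buchberger_output :: "poly3 set \<Rightarrow> poly3 set \<Rightarrow> bool" where
  "buchberger_output F G \<longleftrightarrow> buchberger_step\<^sup>*\<^sup>* F G \<and> (\<nexists>G'. buchberger_step G G')"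

text \<open>
  The elimination ideal of \<open>I\<close> consists of the members of \<open>I\<close> that involve only \<open>\<lambda>\<close>; an eliminant
  is a polynomial with real coefficients generating it (possibly \<open>0\<close>, if the ideal is zero).
\<close>

definition lambda_part :: "poly3 set \<Rightarrow> complex poly set" where
  "lambda_part S = {p. [:[:p:]:] \<in> S}"

definition eliminant :: "poly3 set \<Rightarrow> real poly \<Rightarrow> bool" where
  "eliminant F R \<longleftrightarrow> lambda_part (ideal_gen F) = ideal_gen {map_poly complex_of_real R}"

end

theory Submission
  imports Defs
begin

text \<open>
  The function \<open>x \<mapsto> Tr (\<rho> (F - x)\<^sup>2)\<close> has its minimum, the variance, at \<open>x = Tr (\<rho> F)\<close>, so the sum of the
  variances is the least value of \<open>Tr (\<rho> S(x, y))\<close>, where \<open>S(x, y)\<close> is the shifted operator, and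
  minimising over \<open>\<rho>\<close> first gives \<open>\<lambda>\<^sub>m\<^sub>i\<^sub>n(S(x, y))\<close>. If \<open>m\<close> is the overall minimum, then all
  \<open>S(x, y) - m\<close> are positive semidefinite, so \<open>D(m, x, y)\<close> is nonnegative for real \<open>x, y\<close> and vanishes
  at a minimiser, where its derivatives must therefore vanish too. Conversely a real common zero
  \<open>(c, x, y)\<close> makes \<open>c\<close> an eigenvalue of \<open>S(x, y)\<close>, whence \<open>m \<le> c\<close>. Conjugation of coefficients fixes
  \<open>D\<close>, so the monic generator of the elimination ideal is real. Buchberger's criterion is proved by
  lowering, step by step, the largest leading monomial in a representation of an ideal member.
\<close>

section \<open>Hermitian and positive semidefinite matrices\<close>

text \<open>All quadratic forms are handled through the real inner product of
  \<open>complex^'n\<close>, so that the Euclidean facts on norms, orthogonality and compactness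
  apply to them directly.\<close>

lemma Re_cinner: "Re (cinner u v) = u \<bullet> v"
  by (simp add: cinner_def inner_vec_def inner_complex_def)

lemma of_real_vector_smult: "(of_real r :: complex) *s v = r *\<^sub>R v"
  by (simp add: vec_eq_iff scaleR_conv_of_real[where 'a=complex])

lemma matrix_vector_mult_scaleR_left: "(r *\<^sub>R A) *v v = r *\<^sub>R (A *v (v :: complex^'n))"
  by (simp add: vec_eq_iff matrix_vector_mult_def scaleR_sum_right)

lemma matrix_vector_mult_scaleR_right: "A *v (r *\<^sub>R v) = r *\<^sub>R (A *v (v :: complex^'n))"
  by (simp add: vec_eq_iff matrix_vector_mult_def scaleR_sum_right)

lemma hermitian_nth: "hermitian A \<Longrightarrow> cnj (A $ i $ j) = A $ j $ i"
  unfolding hermitian_def conj_transpose_def by (metis vec_lambda_beta)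

lemma hermitianI: "(\<And>i j. cnj (A $ i $ j) = A $ j $ i) \<Longrightarrow> hermitian A"
  by (simp add: hermitian_def conj_transpose_def vec_eq_iff)

lemma hermitian_add: "hermitian A \<Longrightarrow> hermitian B \<Longrightarrow> hermitian (A + B)"
  by (rule hermitianI) (simp add: hermitian_nth)

lemma hermitian_diff: "hermitian A \<Longrightarrow> hermitian B \<Longrightarrow> hermitian (A - B)"
  by (rule hermitianI) (simp add: hermitian_nth)

lemma hermitian_scaleR: "hermitian A \<Longrightarrow> hermitian (r *\<^sub>R A)"
  by (rule hermitianI) (simp add: hermitian_nth)

lemma hermitian_mat_1: "hermitian (mat 1)"
  by (rule hermitianI) (simp add: mat_def)

lemma hermitian_square: "hermitian A \<Longrightarrow> hermitian (A ** A)"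
  by (rule hermitianI) (simp add: matrix_matrix_mult_def hermitian_nth mult.commute)

lemma hermitian_shifted_op: "hermitian X \<Longrightarrow> hermitian Y \<Longrightarrow> hermitian (shifted_op X Y x y)"
  unfolding shifted_op_def
  by (intro hermitian_add hermitian_diff hermitian_scaleR hermitian_square hermitian_mat_1)

lemma hermitian_inner:
  assumes "hermitian A"
  shows "u \<bullet> (A *v v) = (A *v u) \<bullet> v"
proof -
  have "u \<bullet> (A *v v) = (\<Sum>i\<in>UNIV. \<Sum>j\<in>UNIV. Re (cnj (u $ i) * (A $ i $ j * v $ j)))"
    unfolding Re_cinner[symmetric] cinner_def matrix_vector_mult_def
    by (simp only: vec_lambda_beta sum_distrib_left Re_sum)
  also have "\<dots> = (\<Sum>j\<in>UNIV. \<Sum>i\<in>UNIV. Re (cnj (u $ i) * (A $ i $ j * v $ j)))"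
    by (rule sum.swap)
  also have "\<dots> = (\<Sum>j\<in>UNIV. \<Sum>i\<in>UNIV. Re (cnj (A $ j $ i * u $ i) * v $ j))"
    by (simp add: hermitian_nth[OF assms] mult_ac del: times_complex.sel)
  also have "\<dots> = (A *v u) \<bullet> v"
    unfolding Re_cinner[symmetric] cinner_def matrix_vector_mult_def
    by (simp only: vec_lambda_beta sum_distrib_right Re_sum cnj_sum)
  finally show ?thesis .
qed

lemma psd_iff: "psd A \<longleftrightarrow> hermitian A \<and> (\<forall>v. 0 \<le> v \<bullet> (A *v v))"
  by (simp add: psd_def Re_cinner)

text \<open>If \<open>w = A *v v\<close> were nonzero, moving from \<open>v\<close> in direction
  \<open>- w\<close> would change the form by \<open>t * (t * b - 2 * a)\<close>, which is negative
  for small positive \<open>t\<close>.\<close>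

lemma psd_kernel:
  assumes "psd A" and "v \<bullet> (A *v v) = 0"
  shows "A *v v = 0"
proof (rule ccontr)
  let ?w = "A *v v"
  assume "?w \<noteq> 0"
  define a b where "a = ?w \<bullet> ?w" and "b = ?w \<bullet> (A *v ?w)"
  have "a > 0" "b \<ge> 0"
    using \<open>?w \<noteq> 0\<close> assms(1) by (simp_all add: a_def b_def psd_iff)
  \<comment> \<open>Small enough for \<open>t * b <= a\<close>; the added 1 keeps the quotient
    meaningful when \<open>b = 0\<close>.\<close>
  define t where "t = a / (b + 1)"
  have "t > 0" using \<open>a > 0\<close> \<open>b \<ge> 0\<close> by (simp add: t_def)
  have "0 \<le> (v - t *\<^sub>R ?w) \<bullet> (A *v (v - t *\<^sub>R ?w))"
    using assms(1) unfolding psd_iff by blast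
  also have "\<dots> = t * (t * b - 2 * a)"
    using assms hermitian_inner[of A v ?w]
    by (simp add: psd_iff matrix_vector_mult_diff_distrib matrix_vector_mult_scaleR_right
        inner_diff_left inner_diff_right a_def b_def algebra_simps)
  finally have "2 * a \<le> t * b" using \<open>t > 0\<close> by (simp add: zero_le_mult_iff)
  also have "\<dots> \<le> a" using \<open>a > 0\<close> \<open>b \<ge> 0\<close> by (simp add: t_def field_simps)
  finally show False using \<open>a > 0\<close> by simp
qed

section \<open>The least eigenvalue as the minimum of the quadratic form on the unit sphere\<close>

lemma ex_min_on_sphere:
  fixes f :: "complex^'n \<Rightarrow> real"
  assumes "continuous_on UNIV f"
  obtains v where "norm v = 1" "\<And>w. norm w = 1 \<Longrightarrow> f v \<le> f w"
proof -
  have "sphere (0 :: complex^'n) 1 \<noteq> {}" using vector_choose_size[of 1] by auto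
  then have "\<exists>v\<in>sphere 0 1. \<forall>w\<in>sphere 0 1. f v \<le> f w"
    using assms by (intro continuous_attains_inf compact_sphere) (auto intro: continuous_on_subset)
  then show ?thesis using that by auto
qed

lemma continuous_on_form: "continuous_on UNIV (\<lambda>v :: complex^'n. v \<bullet> (A *v v))"
  by (intro continuous_intros linear_continuous_on matrix_vector_mul_bounded_linear)

lemma eigenvalue_of_real_iff:
  "eigenvalue A (of_real c) \<longleftrightarrow> (\<exists>v. norm v = 1 \<and> A *v v = c *\<^sub>R v)"
proof
  assume "eigenvalue A (of_real c)"
  then obtain v where "v \<noteq> 0" "A *v v = c *\<^sub>R v"
    unfolding eigenvalue_def of_real_vector_smult by blast
  then show "\<exists>v. norm v = 1 \<and> A *v v = c *\<^sub>R v"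
    by (intro exI[of _ "(1 / norm v) *\<^sub>R v"]) (simp add: matrix_vector_mult_scaleR_right)
next
  assume "\<exists>v. norm v = 1 \<and> A *v v = c *\<^sub>R v"
  then show "eigenvalue A (of_real c)"
    unfolding eigenvalue_def of_real_vector_smult by (metis norm_zero zero_neq_one)
qed

text \<open>Unit eigenvectors of distinct eigenvalues are orthogonal, hence linearly independent,
  and the dimension is finite. Finiteness is what gives the \<open>Min\<close> in
  \<open>lambda_min\<close> its meaning.\<close>

lemma finite_real_eigenvalues:
  assumes "hermitian A"
  shows "finite {c :: real. eigenvalue A (of_real c)}" (is "finite ?E")
proof -
  define v where "v c = (SOME v. norm v = 1 \<and> A *v v = c *\<^sub>R v)" for c
  have v: "norm (v c) = 1" "A *v v c = c *\<^sub>R v c" if "c \<in> ?E" for c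
    using that someI_ex[of "\<lambda>v. norm v = 1 \<and> A *v v = c *\<^sub>R v"]
    by (simp_all add: v_def eigenvalue_of_real_iff)
  have orth: "v c \<bullet> v d = 0" if "c \<in> ?E" "d \<in> ?E" "c \<noteq> d" for c d
  proof -
    have "d * (v c \<bullet> v d) = c * (v c \<bullet> v d)"
      using hermitian_inner[OF assms, of "v c" "v d"] v that by simp
    then show ?thesis using that(3) by simp
  qed
  have inj: "inj_on v ?E"
    using orth v by (intro inj_onI) (metis norm_zero inner_eq_zero_iff zero_neq_one)
  have "independent (v ` ?E)"
  proof (rule pairwise_orthogonal_independent)
    show "pairwise orthogonal (v ` ?E)"
      unfolding pairwise_def orthogonal_def using orth by auto
    show "0 \<notin> v ` ?E" using v(1) by force
  qed
  then have "finite (v ` ?E)" by (rule independent_imp_finite)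
  then show ?thesis using inj by (rule finite_imageD)
qed

lemma psd_diff_lambda:
  assumes "hermitian A" and "\<And>w. c * (w \<bullet> w) \<le> w \<bullet> (A *v w)"
  shows "psd (A - c *\<^sub>R mat 1)"
  using assms
  by (simp add: psd_iff hermitian_diff hermitian_scaleR hermitian_mat_1 inner_diff_right
      matrix_vector_mult_diff_rdistrib matrix_vector_mult_scaleR_left)

text \<open>Rayleigh's principle: with \<open>c\<close> the minimum of the form on the unit sphere,
  \<open>A - c *\<^sub>R mat 1\<close> is positive semidefinite and its form vanishes at the
  minimiser, which \<open>psd_kernel\<close> turns into an eigenvector.\<close>

lemma ex_least_eigenvalue:
  assumes "hermitian A"
  obtains c :: real where "eigenvalue A (of_real c)" "psd (A - c *\<^sub>R mat 1)"
proof -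
  obtain v where v: "norm v = 1" "\<And>w. norm w = 1 \<Longrightarrow> v \<bullet> (A *v v) \<le> w \<bullet> (A *v w)"
    using ex_min_on_sphere[OF continuous_on_form] by blast
  define c where "c = v \<bullet> (A *v v)"
  have "c * (w \<bullet> w) \<le> w \<bullet> (A *v w)" for w
  proof (cases "w = 0")
    case False
    then have "c \<le> ((1 / norm w) *\<^sub>R w) \<bullet> (A *v ((1 / norm w) *\<^sub>R w))"
      unfolding c_def by (intro v(2)) simp
    also have "\<dots> = (w \<bullet> (A *v w)) / (w \<bullet> w)"
      by (simp add: matrix_vector_mult_scaleR_right power2_norm_eq_inner[symmetric] power2_eq_square)
    finally show ?thesis using False by (simp add: field_simps)
  qed simp
  then have psd: "psd (A - c *\<^sub>R mat 1)"
    using assms by (intro psd_diff_lambda)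
  have "v \<bullet> v = 1" using v(1) by (simp add: power2_norm_eq_inner[symmetric])
  then have "(A - c *\<^sub>R mat 1) *v v = 0"
    by (intro psd_kernel[OF psd]) (simp add: c_def matrix_vector_mult_diff_rdistrib
        matrix_vector_mult_scaleR_left inner_diff_right)
  then have "eigenvalue A (of_real c)"
    unfolding eigenvalue_of_real_iff using v(1)
    by (intro exI[of _ v]) (simp add: matrix_vector_mult_diff_rdistrib matrix_vector_mult_scaleR_left)
  then show ?thesis using that psd by blast
qed

lemma psd_diff_eigenvalue_le:
  assumes "psd (A - c *\<^sub>R mat 1)" and "eigenvalue A (of_real d)"
  shows "c \<le> d"
proof -
  obtain v where v: "norm v = 1" "A *v v = d *\<^sub>R v"
    using assms(2) unfolding eigenvalue_of_real_iff by blast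
  have "0 \<le> v \<bullet> ((A - c *\<^sub>R mat 1) *v v)"
    using assms(1) unfolding psd_iff by blast
  then show ?thesis
    using v by (simp add: matrix_vector_mult_diff_rdistrib matrix_vector_mult_scaleR_left
        inner_diff_right power2_norm_eq_inner[symmetric])
qed

lemma lambda_min:
  assumes "hermitian A"
  shows "eigenvalue A (of_real (lambda_min A))" "psd (A - lambda_min A *\<^sub>R mat 1)"
proof -
  obtain c where c: "eigenvalue A (of_real c)" "psd (A - c *\<^sub>R mat 1)"
    using ex_least_eigenvalue[OF assms] by blast
  have "lambda_min A = c"
    unfolding lambda_min_def
    by (rule Min_eqI) (use finite_real_eigenvalues[OF assms] c psd_diff_eigenvalue_le in auto)
  with c show "eigenvalue A (of_real (lambda_min A))" "psd (A - lambda_min A *\<^sub>R mat 1)" by auto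
qed

lemma lambda_min_le:
  assumes "hermitian A" and "eigenvalue A (of_real c)"
  shows "lambda_min A \<le> c"
  using psd_diff_eigenvalue_le[OF lambda_min(2)] assms by blast


section \<open>Traces of products of positive semidefinite matrices\<close>

text \<open>The operator |v><v| of Dirac's notation; for a unit vector it is the pure state
  belonging to \<open>v\<close>.\<close>

definition outer :: "complex^'n \<Rightarrow> complex^'n^'n" where
  "outer v = (\<chi> i j. v $ i * cnj (v $ j))"

lemma hermitian_outer: "hermitian (outer v)"
  by (rule hermitianI) (simp add: outer_def)

lemma outer_mult_vector: "outer v *v u = cinner v u *s v"
  by (simp add: outer_def vec_eq_iff matrix_vector_mult_def cinner_def sum_distrib_left mult_ac)

lemma psd_outer: "psd (outer v)"
proof -
  have "u \<bullet> (outer v *v u) = (cmod (cinner v u))\<^sup>2" for u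
  proof -
    have "cinner u v = cnj (cinner v u)"
      by (simp add: cinner_def mult.commute)
    moreover have "cinner u (outer v *v u) = cinner v u * cinner u v"
      by (simp add: outer_mult_vector cinner_def sum_distrib_left mult_ac)
    ultimately have "cinner u (outer v *v u) = of_real ((cmod (cinner v u))\<^sup>2)"
      by (simp add: complex_norm_square[symmetric])
    then show ?thesis
      unfolding Re_cinner[symmetric] by simp
  qed
  then show ?thesis by (simp add: psd_iff hermitian_outer)
qed

lemma matrix_add_rdistrib: "(A + B) ** C = A ** C + B ** (C :: 'a::semiring_1^'n^'m)"
  by (simp add: vec_eq_iff matrix_matrix_mult_def distrib_right sum.distrib)

lemma trace_scaleR_mult: "trace ((r *\<^sub>R A) ** B) = r *\<^sub>R trace (A ** (B :: complex^'n^'n))"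
  by (simp add: trace_def matrix_matrix_mult_def scaleR_sum_right)

lemma trace_mult_scaleR: "trace (A ** (r *\<^sub>R B)) = r *\<^sub>R trace (A ** (B :: complex^'n^'n))"
  by (simp add: trace_def matrix_matrix_mult_def scaleR_sum_right)

lemma trace_outer_mult: "trace (outer v ** B) = cinner v (B *v v)"
proof -
  have "trace (outer v ** B) = (\<Sum>i\<in>UNIV. \<Sum>j\<in>UNIV. v $ i * cnj (v $ j) * B $ j $ i)"
    by (simp add: trace_def outer_def matrix_matrix_mult_def)
  also have "\<dots> = (\<Sum>j\<in>UNIV. \<Sum>i\<in>UNIV. v $ i * cnj (v $ j) * B $ j $ i)"
    by (rule sum.swap)
  also have "\<dots> = cinner v (B *v v)"
    by (simp add: cinner_def matrix_vector_mult_def sum_distrib_left mult_ac)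
  finally show ?thesis .
qed

lemma matrix_vector_mult_axis: "(A :: complex^'n^'n) *v axis i 1 = (\<chi> k. A $ k $ i)"
  by (simp add: vec_eq_iff matrix_vector_mult_def axis_def if_distrib cong: if_cong)

lemma inner_axis_complex: "(c *s axis i 1) \<bullet> (u :: complex^'n) = Re (cnj c * u $ i)"
proof -
  have "c *s axis i 1 = axis i c"
    by (simp add: vec_eq_iff axis_def)
  then show ?thesis
    by (simp add: inner_axis' inner_complex_def)
qed

lemma psd_diagonal:
  assumes "psd A"
  shows "A $ i $ i = of_real (Re (A $ i $ i))" "0 \<le> Re (A $ i $ i)"
proof -
  have "cnj (A $ i $ i) = A $ i $ i"
    using assms by (auto simp: psd_iff hermitian_nth)
  then show "A $ i $ i = of_real (Re (A $ i $ i))"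
    by (simp add: complex_eq_iff)
  show "0 \<le> Re (A $ i $ i)"
    using assms inner_axis_complex[of 1 i "A *v axis i 1"] unfolding psd_iff
    by (metis (no_types, lifting) complex_cnj_one matrix_vector_mult_axis mult_1 vec_lambda_beta
        vector_smult_lid)
qed

text \<open>The form at the i-th basis vector is the i-th diagonal entry, so
  \<open>psd_kernel\<close> annihilates every column.\<close>

lemma psd_zero_diagonal:
  assumes "psd A" and "\<And>i. A $ i $ i = 0"
  shows "A = 0"
proof -
  have "A *v axis i 1 = 0" for i
    using inner_axis_complex[of 1 i "A *v axis i 1"] assms(2)
    by (intro psd_kernel[OF assms(1)]) (simp add: matrix_vector_mult_axis)
  then show ?thesis
    by (simp add: matrix_vector_mult_axis vec_eq_iff)
qed

text \<open>One step of Cholesky's decomposition: subtracting a multiple of \<open>outer w\<close>, where \<open>w\<close> is the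
  \<open>i\<close>-th column, clears row and column \<open>i\<close> and keeps the matrix positive semidefinite.\<close>

lemma psd_cholesky_step:
  assumes "psd A" and "A $ i $ i \<noteq> 0"
  defines "r \<equiv> Re (A $ i $ i)" and "w \<equiv> A *v axis i 1"
  defines "A' \<equiv> A - (1 / r) *\<^sub>R outer w"
  shows "r > 0" "psd A'" "{k. A' $ k $ k \<noteq> 0} \<subset> {k. A $ k $ k \<noteq> 0}"
proof -
  have herm: "hermitian A" using assms(1) by (simp add: psd_iff)
  have Aii: "A $ i $ i = of_real r"
    using psd_diagonal[OF assms(1)] r_def by simp
  show "r > 0"
    using psd_diagonal[OF assms(1), of i] assms(2) unfolding r_def
    by (metis of_real_0 order_le_less)
  have w: "w $ k = A $ k $ i" for k
    by (simp add: w_def matrix_vector_mult_axis)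
  have form: "u \<bullet> (A' *v u) \<ge> 0" for u
  proof -
    define z where "z = (A *v u) $ i"
    \<comment> \<open>Completing the square: the shift along the i-th basis vector makes the i-th
      entry of \<open>A *v u'\<close> vanish, and the form of \<open>A'\<close> at \<open>u\<close>
      becomes the form of \<open>A\<close> at \<open>u'\<close>.\<close>
    define u' where "u' = u - (z / r) *s axis i 1"
    have z: "cinner w u = z"
      by (simp add: z_def cinner_def w hermitian_nth[OF herm] matrix_vector_mult_def)
    have "A *v u' = A *v u - (z / r) *s w"
      by (simp add: u'_def w_def matrix_vector_mult_diff_distrib vector_scalar_commute)
    also have "\<dots> = A' *v u"
      unfolding A'_def matrix_vector_mult_diff_rdistrib matrix_vector_mult_scaleR_left
        outer_mult_vector z
      by (simp add: vec_eq_iff scaleR_conv_of_real[where 'a=complex])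
    finally have A': "A *v u' = A' *v u" .
    have "(A *v u') $ i = 0"
      using \<open>r > 0\<close> \<open>A *v u' = A *v u - (z / r) *s w\<close> by (simp add: z_def[symmetric] w Aii)
    then have "u \<bullet> (A' *v u) = u' \<bullet> (A *v u')"
      using inner_axis_complex[of "z / r" i "A *v u'"]
      by (simp add: A'[symmetric] u'_def inner_diff_left)
    then show ?thesis using assms(1) by (simp add: psd_iff)
  qed
  then show psd: "psd A'"
    unfolding psd_iff A'_def by (auto intro: hermitian_diff hermitian_scaleR hermitian_outer herm)
  have diag: "A' $ k $ k = A $ k $ k - of_real ((cmod (A $ k $ i))\<^sup>2 / r)" for k
    by (simp add: A'_def outer_def w complex_norm_square[symmetric] scaleR_conv_of_real[where 'a=complex] field_simps)
  \<comment> \<open>Diagonal entries can only decrease, but those of \<open>A'\<close> are still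
    nonnegative, so a zero stays zero.\<close>
  have "A' $ k $ k = 0" if "A $ k $ k = 0" for k
  proof -
    have "0 \<le> Re (A' $ k $ k)" by (rule psd_diagonal[OF psd])
    then show ?thesis
      using that \<open>r > 0\<close> by (simp add: diag divide_le_0_iff)
  qed
  moreover have "A' $ i $ i = 0"
    using \<open>r > 0\<close> by (simp add: diag Aii power2_eq_square)
  ultimately show "{k. A' $ k $ k \<noteq> 0} \<subset> {k. A $ k $ k \<noteq> 0}"
    using assms(2) by blast
qed

text \<open>Cholesky steps peel off positive multiples of matrices \<open>outer w\<close>, each
  contributing the form of \<open>B\<close> at \<open>w\<close> to the trace. The number of nonzero
  diagonal entries drops every time, and once it is 0 the matrix itself is 0.\<close>

lemma psd_trace_mult_nonneg:
  assumes "psd A" and "psd B"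
  shows "0 \<le> Re (trace (A ** B))"
  using assms(1)
proof (induction "card {k. A $ k $ k \<noteq> 0}" arbitrary: A rule: less_induct)
  case less
  show ?case
  proof (cases "\<forall>i. A $ i $ i = 0")
    case True
    then have "A = 0" using psd_zero_diagonal[OF less.prems] by blast
    then show ?thesis by (simp add: trace_def matrix_matrix_mult_def)
  next
    case False
    then obtain i where i: "A $ i $ i \<noteq> 0" by blast
    define r w A' where "r = Re (A $ i $ i)" "w = A *v axis i 1" "A' = A - (1 / r) *\<^sub>R outer w"
    note step = psd_cholesky_step[OF less.prems i, folded r_w_A'_def(1,2), folded r_w_A'_def(3)]
    have "A ** B = A' ** B + ((1 / r) *\<^sub>R outer w) ** B"
      by (simp add: r_w_A'_def(3) flip: matrix_add_rdistrib)
    then have "Re (trace (A ** B)) = Re (trace (A' ** B)) + (1 / r) * (w \<bullet> (B *v w))"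
      by (simp add: trace_add trace_scaleR_mult trace_outer_mult Re_cinner)
    moreover have "0 \<le> Re (trace (A' ** B))"
      using step by (intro less.hyps psubset_card_mono) auto
    moreover have "0 \<le> w \<bullet> (B *v w)" using assms(2) by (simp add: psd_iff)
    ultimately show ?thesis using step(1) by simp
  qed
qed


section \<open>Minimising the sum of the variances\<close>

lemma expectation_add: "expectation \<rho> (A + B) = expectation \<rho> A + expectation \<rho> B"
  by (simp add: expectation_def matrix_add_ldistrib trace_add)

lemma expectation_scaleR: "expectation \<rho> (r *\<^sub>R A) = r * expectation \<rho> A"
  by (simp add: expectation_def trace_mult_scaleR)

lemma expectation_diff: "expectation \<rho> (A - B) = expectation \<rho> A - expectation \<rho> B"
  using expectation_add[of \<rho> "A - B" B] by simp

lemma expectation_mat_1: "\<rho> \<in> density_matrices \<Longrightarrow> expectation \<rho> (mat 1) = 1"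
  by (simp add: expectation_def density_matrices_def)

text \<open>Completing the squares in \<open>x\<close> and \<open>y\<close>. The excess over the sum
  of the variances is nonnegative and vanishes at the two mean values, which yields both
  inequalities between the two minima.\<close>

lemma expectation_shifted_op:
  assumes "\<rho> \<in> density_matrices"
  shows "expectation \<rho> (shifted_op X Y x y) =
    variance \<rho> X + variance \<rho> Y + (x - expectation \<rho> X)\<^sup>2 + (y - expectation \<rho> Y)\<^sup>2"
  using expectation_mat_1[OF assms]
  by (simp add: shifted_op_def expectation_add expectation_diff expectation_scaleR variance_def
      power2_eq_square algebra_simps)

lemma lambda_min_le_expectation:
  assumes "hermitian A" and "\<rho> \<in> density_matrices"
  shows "lambda_min A \<le> expectation \<rho> A"
proof -
  have "0 \<le> expectation \<rho> (A - lambda_min A *\<^sub>R mat 1)"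
    unfolding expectation_def
    using assms by (intro psd_trace_mult_nonneg lambda_min(2)) (auto simp: density_matrices_def)
  then show ?thesis
    by (simp add: expectation_diff expectation_scaleR expectation_mat_1[OF assms(2)])
qed

lemma outer_density:
  assumes "norm v = 1"
  shows "outer v \<in> density_matrices"
proof -
  have "trace (outer v) = of_real (v \<bullet> v)"
    by (simp add: trace_def outer_def inner_vec_def complex_norm_square[symmetric]
        power2_norm_eq_inner[symmetric])
  then show ?thesis
    using assms by (simp add: density_matrices_def psd_outer power2_norm_eq_inner[symmetric])
qed

lemma expectation_outer: "expectation (outer v) A = v \<bullet> (A *v v)"
  by (simp add: expectation_def trace_outer_mult Re_cinner)

lemma ex_lambda_min_expectation:
  assumes "hermitian A"
  shows "\<exists>v. norm v = 1 \<and> expectation (outer v) A = lambda_min A"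
proof -
  obtain v where "norm v = 1" "A *v v = lambda_min A *\<^sub>R v"
    using lambda_min(1)[OF assms] unfolding eigenvalue_of_real_iff by blast
  then show ?thesis
    by (intro exI[of _ v]) (simp add: expectation_outer power2_norm_eq_inner[symmetric])
qed

text \<open>Compactness is applied to the pure states only. With \<open>v\<close> the best of them,
  every \<open>lambda_min\<close> is attained by a pure state and is thus at least
  \<open>?f v\<close>, while the variances of a mixed state are bounded below by
  \<open>lambda_min\<close> at its mean values. So \<open>?f v\<close> bounds both sets from
  below.\<close>

lemma ex_min_variance_sum:
  assumes "hermitian X" and "hermitian Y"
  obtains m where "is_min {variance \<rho> X + variance \<rho> Y | \<rho>. \<rho> \<in> density_matrices} m"
    "is_min {lambda_min (shifted_op X Y x y) | x y. True} m"
proof -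
  let ?f = "\<lambda>v. variance (outer v) X + variance (outer v) Y"
  have "continuous_on UNIV ?f"
    unfolding variance_def expectation_outer by (intro continuous_intros continuous_on_form)
  then obtain v where v: "norm v = 1" "\<And>w. norm w = 1 \<Longrightarrow> ?f v \<le> ?f w"
    by (rule ex_min_on_sphere) blast
  note herm = hermitian_shifted_op[OF assms]
  have lower: "?f v \<le> lambda_min (shifted_op X Y x y)" for x y
  proof -
    obtain w where w: "norm w = 1"
        "expectation (outer w) (shifted_op X Y x y) = lambda_min (shifted_op X Y x y)"
      using ex_lambda_min_expectation[OF herm] by blast
    have "?f w \<le> expectation (outer w) (shifted_op X Y x y)"
      using outer_density[OF w(1)] by (simp add: expectation_shifted_op)
    then show ?thesis using v(2)[OF w(1)] w(2) by simp
  qed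
  have upper: "lambda_min (shifted_op X Y (expectation \<rho> X) (expectation \<rho> Y)) \<le> variance \<rho> X + variance \<rho> Y"
    if "\<rho> \<in> density_matrices" for \<rho>
    using lambda_min_le_expectation[OF herm that, of "expectation \<rho> X" "expectation \<rho> Y"]
    by (simp add: expectation_shifted_op[OF that])
  have "is_min {variance \<rho> X + variance \<rho> Y | \<rho>. \<rho> \<in> density_matrices} (?f v)"
    unfolding is_min_def using outer_density[OF v(1)] upper lower order_trans by blast
  \<comment> \<open>At the mean values of \<open>outer v\<close> the bounds \<open>upper\<close> and
    \<open>lower\<close> coincide, so the value is attained although the real plane is not
    compact.\<close>
  moreover have "is_min {lambda_min (shifted_op X Y x y) | x y. True} (?f v)"
    unfolding is_min_def using antisym[OF upper[OF outer_density[OF v(1)]] lower, symmetric] lower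
    by auto
  ultimately show ?thesis by (rule that)
qed


section \<open>Determinants\<close>

lemma det_eq_0_iff_ker:
  fixes A :: "'a::field^'n^'n"
  shows "det A = 0 \<longleftrightarrow> (\<exists>v. v \<noteq> 0 \<and> A *v v = 0)"
  using invertible_det_nz[of A] matrix_left_invertible_ker[of A] invertible_left_inverse[of A] by blast

lemma eigenvalue_iff_det: "eigenvalue A (of_real c) \<longleftrightarrow> det (A - c *\<^sub>R mat 1) = 0"
  unfolding eigenvalue_def det_eq_0_iff_ker of_real_vector_smult
  by (simp add: matrix_vector_mult_diff_rdistrib matrix_vector_mult_scaleR_left)

text \<open>Conjugating the entries of a Hermitian matrix transposes it, which leaves the
  determinant unchanged.\<close>

lemma Im_det_hermitian:
  assumes "hermitian A"
  shows "Im (det A) = 0"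
proof -
  have "cnj (det A) = (\<Sum>p | p permutes UNIV. of_int (sign p) * (\<Prod>i\<in>UNIV. cnj (A $ i $ p i)))"
    by (simp add: det_def)
  also have "\<dots> = det (transpose A)"
    by (simp add: det_def transpose_def hermitian_nth[OF assms])
  finally show ?thesis
    by (simp add: complex_eq_iff)
qed

text \<open>On the segment from a positive semidefinite matrix to the identity the determinant is real and
  vanishes at most at the start, so it keeps the sign it has at the identity.\<close>

lemma Re_det_psd_nonneg:
  assumes "psd A"
  shows "0 \<le> Re (det A)"
proof (rule ccontr)
  assume neg: "\<not> 0 \<le> Re (det A)"
  define M where "M t = (1 - t) *\<^sub>R A + t *\<^sub>R mat 1" for t :: real
  have herm: "hermitian (M t)" for t
    using assms unfolding M_def psd_iff
    by (intro hermitian_add hermitian_scaleR hermitian_mat_1) blast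
  have "continuous_on {0..1} (\<lambda>t. Re (det (M t)))"
    unfolding det_def M_def by (intro continuous_intros)
  moreover have "Re (det (M 0)) \<le> 0" "0 \<le> Re (det (M 1))"
    using neg by (simp_all add: M_def)
  ultimately obtain t where t: "0 \<le> t" "t \<le> 1" "Re (det (M t)) = 0"
    using IVT'[of "\<lambda>t. Re (det (M t))" 0 0 1] by auto
  then have "t > 0" using neg by (cases "t = 0") (auto simp: M_def)
  have "det (M t) = 0"
    using t(3) Im_det_hermitian[OF herm] by (simp add: complex_eq_iff)
  then obtain v where v: "v \<noteq> 0" "M t *v v = 0"
    unfolding det_eq_0_iff_ker by blast
  have "0 = v \<bullet> (M t *v v)" using v by simp
  also have "\<dots> = (1 - t) * (v \<bullet> (A *v v)) + t * (v \<bullet> v)"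
    by (simp add: M_def matrix_vector_mult_add_rdistrib matrix_vector_mult_scaleR_left inner_add_right)
  also have "\<dots> > 0"
    using assms t \<open>t > 0\<close> v(1) unfolding psd_iff by (intro add_nonneg_pos mult_nonneg_nonneg) auto
  finally show False by simp
qed

section \<open>Ideals and ring homomorphisms\<close>

text \<open>Ideals are the submodules of the ring regarded as a module over itself, so facts about
  spans become facts about \<open>ideal_gen\<close>.\<close>

interpretation ideal: module "(*) :: 'a::comm_ring_1 \<Rightarrow> 'a \<Rightarrow> 'a"
  by unfold_locales (simp_all add: algebra_simps)

text \<open>Covers evaluation of polynomials, conjugation of coefficients and the embedding of the
  reals into the complex numbers.\<close>

locale unital_ring_hom =
  fixes h :: "'a::comm_ring_1 \<Rightarrow> 'b::comm_ring_1"
  assumes hom_one: "h 1 = 1"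
    and hom_add: "h (a + b) = h a + h b"
    and hom_mult: "h (a * b) = h a * h b"
begin

lemma hom_zero: "h 0 = 0"
  using hom_add[of 0 0] by simp

lemma hom_uminus: "h (- a) = - h a"
  using hom_add[of a "- a"] by (simp add: hom_zero eq_neg_iff_add_eq_0 add.commute)

lemma hom_diff: "h (a - b) = h a - h b"
  using hom_add[of a "- b"] by (simp add: hom_uminus)

lemma hom_sum: "h (sum f A) = (\<Sum>i\<in>A. h (f i))"
  by (induction A rule: infinite_finite_induct) (simp_all add: hom_zero hom_add)

lemma hom_prod: "h (prod f A) = (\<Prod>i\<in>A. h (f i))"
  by (induction A rule: infinite_finite_induct) (simp_all add: hom_one hom_mult)

lemma hom_power: "h (a ^ n) = h a ^ n"
  by (induction n) (simp_all add: hom_one hom_mult)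

lemma hom_of_nat: "h (of_nat n) = of_nat n"
  by (induction n) (simp_all add: hom_zero hom_one hom_add)

lemma hom_of_int: "h (of_int z) = of_int z"
  by (cases z) (simp_all add: hom_of_nat hom_uminus hom_diff hom_one)

lemma hom_numeral: "h (numeral k) = numeral k"
  using hom_of_nat[of "numeral k"] by simp

lemma hom_det: "h (det A) = det (\<chi> i j. h (A $ i $ j))"
  by (simp add: det_def hom_sum hom_mult hom_of_int hom_prod)

lemma hom_map_poly: "unital_ring_hom (map_poly h)"
proof
  show "map_poly h 1 = 1"
    by (simp add: hom_one)
  show "map_poly h (p + q) = map_poly h p + map_poly h q" for p q
    by (rule poly_eqI) (simp add: coeff_map_poly hom_zero hom_add)
  show "map_poly h (p * q) = map_poly h p * map_poly h q" for p q
    by (rule poly_eqI) (simp add: coeff_map_poly hom_zero hom_mult hom_sum coeff_mult)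
qed

text \<open>Used in two ways: with \<open>T\<close> empty, a homomorphism killing the generators
  kills the ideal; with \<open>T = S\<close>, one that fixes the generators maps the ideal into
  itself.\<close>

lemma hom_ideal_gen:
  assumes "x \<in> ideal_gen S" and "\<And>s. s \<in> S \<Longrightarrow> h s \<in> ideal_gen T"
  shows "h x \<in> ideal_gen T"
  using assms(1)
proof (induction rule: ideal.span_induct_alt)
  case base
  show ?case by (simp add: hom_zero ideal.span_zero)
next
  case (step c s y)
  then show ?case
    using assms(2) by (simp add: hom_add hom_mult ideal.span_add ideal.span_scale)
qed

end

lemma unital_ring_hom_poly: "unital_ring_hom (\<lambda>p. poly p a)"
  by unfold_locales simp_all

lemma unital_ring_hom_eval3: "unital_ring_hom (\<lambda>p. eval3 p c a b)"
  unfolding eval3_def by unfold_locales simp_all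

lemma eval3_ideal_gen:
  assumes "common_zero S c a b" and "p \<in> ideal_gen S"
  shows "eval3 p c a b = 0"
  using unital_ring_hom.hom_ideal_gen[OF unital_ring_hom_eval3 assms(2), of c a b "{}"] assms(1)
  by (simp add: common_zero_def)

lemma common_zero_cong_ideal_gen:
  assumes "ideal_gen S = ideal_gen T"
  shows "common_zero S c a b \<longleftrightarrow> common_zero T c a b"
  using assms eval3_ideal_gen ideal.span_base unfolding common_zero_def by metis


section \<open>The lexicographic monomial order\<close>

text \<open>On triples the order \<open>\<le>\<close> is componentwise and stands for divisibility,
  so the monomial order gets its own symbol. As a lexicographic product it inherits
  well-foundedness.\<close>

definition mono_less :: "nat \<times> nat \<times> nat \<Rightarrow> nat \<times> nat \<times> nat \<Rightarrow> bool" (infix "\<lhd>" 50) where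
  "a \<lhd> b \<longleftrightarrow> (a, b) \<in> less_than <*lex*> less_than <*lex*> less_than"

lemma mono_less_simp [simp]:
  "(i, j, k) \<lhd> (i', j', k') \<longleftrightarrow> i < i' \<or> i = i' \<and> (j < j' \<or> j = j' \<and> k < k')"
  by (auto simp: mono_less_def)

lemma wfp_mono_less: "wfp (\<lhd>)"
  unfolding mono_less_def wfp_wf_eq by auto

lemma mono_less_irrefl [simp]: "\<not> a \<lhd> a"
  by (cases a) auto

lemma mono_less_trans: "a \<lhd> b \<Longrightarrow> b \<lhd> c \<Longrightarrow> a \<lhd> c"
  by (cases a; cases b; cases c) auto

lemma mono_less_linear: "a \<lhd> b \<or> a = b \<or> b \<lhd> a"
  by (cases a; cases b) auto

lemma mono_less_add: "a \<lhd> b \<Longrightarrow> d + a \<lhd> d + b"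
  by (cases a; cases b; cases d) auto

lemma mono_less_diff: "d \<le> b \<Longrightarrow> d + a \<lhd> b \<Longrightarrow> a \<lhd> b - d"
  by (cases a; cases b; cases d) auto

lemma exps_diff_add: "d \<le> e \<Longrightarrow> (e - d) + d = (e :: nat \<times> nat \<times> nat)"
  by (cases d; cases e) auto

lemma exps_add_diff_cancel: "d + e - d = (e :: nat \<times> nat \<times> nat)"
  by (cases d; cases e) auto

lemma exps_le_add: "d \<le> d + (e :: nat \<times> nat \<times> nat)" "d \<le> e + d"
  by (cases d; cases e; auto)+


section \<open>Coefficients and leading terms\<close>

definition coeff3 :: "poly3 \<Rightarrow> nat \<times> nat \<times> nat \<Rightarrow> complex" where
  "coeff3 p e = (case e of (i, j, k) \<Rightarrow> coeff (coeff (coeff p i) j) k)"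

lemma coeff3_simps [simp]:
  "coeff3 0 e = 0"
  "coeff3 (p + q) e = coeff3 p e + coeff3 q e"
  "coeff3 (p - q) e = coeff3 p e - coeff3 q e"
  by (cases e; simp add: coeff3_def)+

lemma term3_zero [simp]: "term3 0 e = 0"
  by (cases e) (simp add: term3_def)

lemma term3_add: "term3 (a + b) e = term3 a e + term3 b e"
  by (cases e) (simp add: term3_def add_monom)

lemma term3_mult: "term3 a d * term3 b e = term3 (a * b) (d + e)"
  by (cases d; cases e) (simp add: term3_def mult_monom)

lemma term3_one: "term3 1 0 = 1"
  by (simp add: term3_def zero_prod_def)

lemma coeff3_term3_mult:
  "coeff3 (term3 a d * p) e = (if d \<le> e then a * coeff3 p (e - d) else 0)"
  by (cases d; cases e) (auto simp: coeff3_def term3_def coeff_monom_mult)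

lemma coeff3_term3: "coeff3 (term3 a d) e = (if e = d then a else 0)"
  by (cases d; cases e) (auto simp: coeff3_def term3_def)

lemma lead_coeff3_eq: "lead_coeff3 p = coeff3 p (lead_exps p)"
  by (simp add: lead_coeff3_def coeff3_def lead_exps_def)

lemma lead_coeff3_nonzero [simp]: "lead_coeff3 p = 0 \<longleftrightarrow> p = 0"
  by (simp add: lead_coeff3_def)

lemma coeff3_above_lead: "lead_exps p \<lhd> e \<Longrightarrow> coeff3 p e = 0"
  by (cases e) (auto simp: coeff3_def lead_exps_def coeff_eq_0)

lemma lead_exps_eqI:
  assumes "coeff3 p e \<noteq> 0" and "\<And>e'. e \<lhd> e' \<Longrightarrow> coeff3 p e' = 0"
  shows "lead_exps p = e"
proof -
  have "p \<noteq> 0" using assms(1) by auto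
  then have "coeff3 p (lead_exps p) \<noteq> 0"
    by (metis lead_coeff3_eq lead_coeff3_nonzero)
  then show ?thesis
    using assms coeff3_above_lead mono_less_linear by metis
qed

lemma lead_exps_less:
  assumes "p \<noteq> 0" and "\<And>e'. \<not> e' \<lhd> e \<Longrightarrow> coeff3 p e' = 0"
  shows "lead_exps p \<lhd> e"
  using assms by (metis lead_coeff3_eq lead_coeff3_nonzero)

lemma coeff3_term3_mult_lead:
  "coeff3 (term3 a d * p) (d + lead_exps p) = a * lead_coeff3 p"
  by (simp add: coeff3_term3_mult exps_add_diff_cancel lead_coeff3_eq exps_le_add)

lemma coeff3_term3_mult_above:
  assumes "d + lead_exps p \<lhd> e"
  shows "coeff3 (term3 a d * p) e = 0"
  using assms by (auto simp: coeff3_term3_mult intro!: coeff3_above_lead mono_less_diff)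

text \<open>The two leading terms cancel. This is the common core of a reduction step and of an
  S-polynomial.\<close>

lemma lead_exps_diff_lead_less:
  assumes "m + lead_exps f = e" "n + lead_exps g = e" and "a * lead_coeff3 f = b * lead_coeff3 g"
    and "term3 a m * f - term3 b n * g \<noteq> 0"
  shows "lead_exps (term3 a m * f - term3 b n * g) \<lhd> e"
proof (rule lead_exps_less[OF assms(4)])
  fix e' assume "\<not> e' \<lhd> e"
  then consider "e' = e" | "e \<lhd> e'" using mono_less_linear by blast
  then show "coeff3 (term3 a m * f - term3 b n * g) e' = 0"
  proof cases
    case 1
    then show ?thesis
      using assms(1-3) coeff3_term3_mult_lead[of a m f] coeff3_term3_mult_lead[of b n g] by simp
  next
    case 2
    then show ?thesis
      using assms(1,2) by (simp add: coeff3_term3_mult_above)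
  qed
qed

lemma lead_exps_diff_lead_term:
  assumes "p - lead_term p \<noteq> 0"
  shows "lead_exps (p - lead_term p) \<lhd> lead_exps p"
proof (rule lead_exps_less[OF assms])
  fix e assume "\<not> e \<lhd> lead_exps p"
  then consider "e = lead_exps p" | "lead_exps p \<lhd> e" "e \<noteq> lead_exps p"
    using mono_less_linear by (metis mono_less_irrefl)
  then show "coeff3 (p - lead_term p) e = 0"
    by cases (simp_all add: lead_term_def coeff3_term3 lead_coeff3_eq coeff3_above_lead)
qed


section \<open>Representations with bounded leading terms\<close>

text \<open>\<open>E\<close> constrains the leading monomials of the summands, not that of the sum;
  cancellation among the summands is what Buchberger's criterion has to control. Bounds below
  \<open>e\<close>, up to \<open>e\<close> and no bound at all are instances.\<close>

inductive rep :: "poly3 set \<Rightarrow> (nat \<times> nat \<times> nat) set \<Rightarrow> poly3 \<Rightarrow> bool" for G E where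
  rep_zero: "rep G E 0"
| rep_step: "rep G E f \<Longrightarrow> g \<in> G \<Longrightarrow> g \<noteq> 0 \<Longrightarrow> m + lead_exps g \<in> E \<Longrightarrow> rep G E (f + term3 a m * g)"

abbreviation rep_below :: "poly3 set \<Rightarrow> nat \<times> nat \<times> nat \<Rightarrow> poly3 \<Rightarrow> bool" where
  "rep_below G e \<equiv> rep G {e'. e' \<lhd> e}"

abbreviation rep_upto :: "poly3 set \<Rightarrow> nat \<times> nat \<times> nat \<Rightarrow> poly3 \<Rightarrow> bool" where
  "rep_upto G e \<equiv> rep G {e'. e' \<lhd> e \<or> e' = e}"

lemma rep_mono:
  assumes "rep G E f" and "E \<subseteq> E'"
  shows "rep G E' f"
  using assms(1) by induction (use assms(2) in \<open>auto intro: rep.intros\<close>)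

lemma rep_add:
  assumes "rep G E f" and "rep G E g"
  shows "rep G E (f + g)"
  using assms(2)
proof induction
  case rep_zero
  then show ?case using assms(1) by simp
next
  case (rep_step g' g m a)
  then show ?case using rep.rep_step[of G E "f + g'" g m a] by (simp add: add.assoc)
qed

lemma rep_single: "g \<in> G \<Longrightarrow> g \<noteq> 0 \<Longrightarrow> m + lead_exps g \<in> E \<Longrightarrow> rep G E (term3 a m * g)"
  using rep_step[OF rep_zero, of g G m E a] by simp

lemma rep_term3_mult:
  assumes "rep G E f" and "\<And>e. e \<in> E \<Longrightarrow> d + e \<in> E'"
  shows "rep G E' (term3 c d * f)"
  using assms(1)
proof induction
  case rep_zero
  then show ?case by (simp add: rep.rep_zero)
next
  case (rep_step f g m a)
  have "rep G E' (term3 c d * f + term3 (c * a) (d + m) * g)"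
    by (rule rep.rep_step) (use rep_step assms(2) in \<open>auto simp: add.assoc\<close>)
  then show ?case
    unfolding distrib_left mult.assoc[symmetric] term3_mult .
qed

lemma rep_upto_add:
  assumes "rep_upto G a f" and "rep_upto G b g"
  shows "\<exists>c\<in>{a, b}. rep_upto G c (f + g)"
proof -
  consider "{e. e \<lhd> a \<or> e = a} \<subseteq> {e. e \<lhd> b \<or> e = b}" | "{e. e \<lhd> b \<or> e = b} \<subseteq> {e. e \<lhd> a \<or> e = a}"
    using mono_less_linear[of a b] mono_less_trans by blast
  then show ?thesis
    by cases (use assms in \<open>blast intro: rep_add rep_mono\<close>)+
qed

text \<open>A representation has finitely many summands, so even for infinite \<open>E\<close> one
  of their leading monomials is largest. This provides the starting point and the next point of the
  descent.\<close>

lemma rep_cases: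
  assumes "rep G E f"
  shows "f = 0 \<or> (\<exists>e\<in>E. rep_upto G e f)"
  using assms
proof induction
  case rep_zero
  then show ?case by simp
next
  case (rep_step f g m a)
  let ?n = "m + lead_exps g"
  have g: "rep_upto G ?n (term3 a m * g)"
    using rep_step by (intro rep_single) auto
  from rep_step.IH show ?case
  proof
    assume "f = 0"
    then show ?thesis using g rep_step(4) by auto
  next
    assume "\<exists>e\<in>E. rep_upto G e f"
    then obtain e where "e \<in> E" "rep_upto G e f" by blast
    then show ?thesis
      using rep_upto_add[OF _ g] rep_step(4) by blast
  qed
qed

lemma coeff3_rep:
  assumes "rep G E f" and "\<And>e'. e' \<in> E \<Longrightarrow> e' \<lhd> e"
  shows "coeff3 f e = 0"
  using assms(1) by induction (use assms(2) in \<open>auto simp: coeff3_term3_mult_above\<close>)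

text \<open>The factor \<open>p\<close> is split into its terms by removing leading terms one after
  the other.\<close>

lemma rep_UNIV_mult:
  assumes "g \<in> G"
  shows "rep G UNIV (p * g)"
proof (cases "g = 0")
  case False
  have "rep G UNIV (p * g)" if "lead_exps p = e" for e
    using that
  proof (induction e arbitrary: p rule: wfp_induct_rule[OF wfp_mono_less])
    case (1 e)
    have "rep G UNIV ((p - lead_term p) * g)"
      using 1 lead_exps_diff_lead_term[of p] rep_zero[of G UNIV]
      by (cases "p - lead_term p = 0") auto
    moreover have "rep G UNIV (lead_term p * g)"
      unfolding lead_term_def by (rule rep_single[OF assms False]) simp
    ultimately show ?case
      using rep_add by (metis diff_add_cancel distrib_right)
  qed
  then show ?thesis by blast
qed (simp add: rep_zero)

lemma rep_UNIV_ideal_gen: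
  assumes "f \<in> ideal_gen G"
  shows "rep G UNIV f"
  using assms
  by (induction rule: ideal.span_induct_alt) (auto intro: rep_zero rep_add rep_UNIV_mult)


section \<open>Reduction\<close>

text \<open>The case \<open>f' = 0\<close> stands apart because \<open>lead_exps 0\<close> is
  \<open>(0, 0, 0)\<close>, which does not lie below the leading monomial of a constant
  \<open>f\<close>.\<close>

lemma reducesE:
  assumes "reduces G f f'"
  obtains g m a where "f \<noteq> 0" "g \<in> G" "g \<noteq> 0" "m + lead_exps g = lead_exps f"
    "f = f' + term3 a m * g" "f' = 0 \<or> lead_exps f' \<lhd> lead_exps f"
proof -
  from assms obtain g where g: "f \<noteq> 0" "g \<in> G" "g \<noteq> 0" "lead_exps g \<le> lead_exps f"
    and f': "f' = f - term3 (lead_coeff3 f / lead_coeff3 g) (lead_exps f - lead_exps g) * g"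
    unfolding reduces_def by blast
  have m: "lead_exps f - lead_exps g + lead_exps g = lead_exps f"
    using g(4) by (rule exps_diff_add)
  have "f' = 0 \<or> lead_exps f' \<lhd> lead_exps f"
    \<comment> \<open>Here \<open>f\<close> is read as \<open>term3 1 0 * f\<close>, to match the
      form of the cancellation lemma.\<close>
    using lead_exps_diff_lead_less[of 0 f "lead_exps f" _ g 1 "lead_coeff3 f / lead_coeff3 g", OF _ m]
      g(3) by (auto simp: f' term3_one)
  then show ?thesis
    using that[OF g(1-3) m] f' by force
qed

lemma reduces_diff_ideal_gen:
  assumes "reduces G f f'"
  shows "f - f' \<in> ideal_gen G"
  using assms by (elim reducesE) (auto intro: ideal.span_scale ideal.span_base)

lemma reduces_rtranclp_diff_ideal_gen:
  assumes "(reduces G)\<^sup>*\<^sup>* f r"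
  shows "f - r \<in> ideal_gen G"
  using assms
proof induction
  case base
  show ?case by (simp add: ideal.span_zero)
next
  case (step y z)
  then show ?case
    using ideal.span_add[OF step.IH reduces_diff_ideal_gen[OF step.hyps(2)]] by simp
qed

text \<open>Every reduction lowers the leading monomial or reaches 0, and 0 is irreducible.\<close>

lemma ex_remainder_of: "\<exists>r. remainder_of G f r"
proof -
  have "\<exists>r. remainder_of G f r" if "lead_exps f = e" for e
    using that
  proof (induction e arbitrary: f rule: wfp_induct_rule[OF wfp_mono_less])
    case (1 e)
    show ?case
    proof (cases "\<exists>f'. reduces G f f'")
      case False
      then show ?thesis unfolding remainder_of_def by blast
    next
      case True
      then obtain f' where f': "reduces G f f'" by blast
      from f' have "f' = 0 \<or> lead_exps f' \<lhd> lead_exps f"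
        by (elim reducesE) auto
      then have "\<exists>r. remainder_of G f' r"
      proof
        assume "f' = 0"
        then show ?thesis unfolding remainder_of_def reduces_def by blast
      qed (use 1 in blast)
      then show ?thesis
        using f' unfolding remainder_of_def by (meson converse_rtranclp_into_rtranclp)
    qed
  qed
  then show ?thesis by blast
qed

text \<open>The multiples subtracted on the way to 0 add up to \<open>f\<close>, and their leading
  monomials never exceed that of \<open>f\<close>.\<close>

lemma rep_of_reduces_to_zero:
  assumes "(reduces G)\<^sup>*\<^sup>* f 0"
  shows "rep_upto G (lead_exps f) f"
  using assms
proof (induction rule: converse_rtranclp_induct)
  case base
  show ?case by (rule rep_zero)
next
  case (step f f')
  from step.hyps(1) obtain g m a where g: "g \<in> G" "g \<noteq> 0" "m + lead_exps g = lead_exps f"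
      "f = f' + term3 a m * g" "f' = 0 \<or> lead_exps f' \<lhd> lead_exps f"
    by (elim reducesE)
  have "rep_upto G (lead_exps f) f'"
    using g(5)
  proof
    assume "lead_exps f' \<lhd> lead_exps f"
    then show ?thesis
      using mono_less_trans by (intro rep_mono[OF step.IH]) blast
  qed (simp add: rep_zero)
  then have "rep_upto G (lead_exps f) (f' + term3 a m * g)"
    using g by (intro rep_step) auto
  then show ?case using g(4) by simp
qed


section \<open>Buchberger's criterion\<close>

lemma s_poly_ideal_gen: "f \<in> G \<Longrightarrow> g \<in> G \<Longrightarrow> s_poly f g \<in> ideal_gen G"
  unfolding s_poly_def Let_def by (intro ideal.span_diff ideal.span_scale ideal.span_base)

lemma s_poly_lead_less:
  assumes "f \<noteq> 0" "g \<noteq> 0" "s_poly f g \<noteq> 0"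
  shows "lead_exps (s_poly f g) \<lhd> sup (lead_exps f) (lead_exps g)"
  using assms unfolding s_poly_def Let_def
  by (intro lead_exps_diff_lead_less exps_diff_add) auto

text \<open>A common multiple \<open>e\<close> of both leading monomials is a multiple of their
  least common multiple, so each such cancelling pair is a monomial times the S-polynomial.\<close>

lemma s_poly_shift:
  assumes "m + lead_exps f = e" "n + lead_exps g = e"
  shows "term3 (1 / lead_coeff3 f) m * f - term3 (1 / lead_coeff3 g) n * g =
    term3 1 (e - sup (lead_exps f) (lead_exps g)) * s_poly f g"
proof -
  let ?s = "sup (lead_exps f) (lead_exps g)"
  have "?s \<le> e" using assms exps_le_add by (metis sup.bounded_iff)
  have shift: "e - ?s + (?s - d) = k" if "k + d = e" "d \<le> ?s" for d k
  proof -
    have "(e - ?s + (?s - d)) + d = k + d"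
      using \<open>?s \<le> e\<close> that by (simp add: add.assoc exps_diff_add)
    then show ?thesis by (simp only: add_right_cancel)
  qed
  show ?thesis
    unfolding s_poly_def Let_def right_diff_distrib mult.assoc[symmetric] term3_mult
    using assms by (simp add: shift)
qed

text \<open>Separates the hypothesis of Buchberger's criterion from the algorithm that establishes
  it.\<close>

locale buchberger_closed =
  fixes G :: "poly3 set"
  assumes s_poly_reduces: "f \<in> G \<Longrightarrow> g \<in> G \<Longrightarrow> f \<noteq> 0 \<Longrightarrow> g \<noteq> 0 \<Longrightarrow> (reduces G)\<^sup>*\<^sup>* (s_poly f g) 0"
begin

lemma rep_s_poly:
  assumes "f \<in> G" "g \<in> G" "f \<noteq> 0" "g \<noteq> 0"
  shows "rep_below G (sup (lead_exps f) (lead_exps g)) (s_poly f g)"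
proof (cases "s_poly f g = 0")
  case False
  have "lead_exps (s_poly f g) \<lhd> sup (lead_exps f) (lead_exps g)"
    using assms False by (intro s_poly_lead_less)
  then show ?thesis
    using mono_less_trans
    by (intro rep_mono[OF rep_of_reduces_to_zero[OF s_poly_reduces[OF assms]]]) blast
qed (simp add: rep_zero)

lemma rep_diff_same_lead:
  assumes "f \<in> G" "g \<in> G" "f \<noteq> 0" "g \<noteq> 0" "m + lead_exps f = e" "n + lead_exps g = e"
  shows "rep_below G e (term3 (1 / lead_coeff3 f) m * f - term3 (1 / lead_coeff3 g) n * g)"
proof -
  let ?s = "sup (lead_exps f) (lead_exps g)"
  have "?s \<le> e" using assms(5,6) exps_le_add by (metis sup.bounded_iff)
  show ?thesis
    unfolding s_poly_shift[OF assms(5,6)]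
  proof (rule rep_term3_mult[OF rep_s_poly[OF assms(1-4)]])
    fix e' assume "e' \<in> {e'. e' \<lhd> ?s}"
    then show "e - ?s + e' \<in> {e'. e' \<lhd> e}"
      using mono_less_add[of e' ?s "e - ?s"] exps_diff_add[OF \<open>?s \<le> e\<close>] by simp
  qed
qed

text \<open>Modulo representations below \<open>e\<close>, all summands with leading monomial \<open>e\<close> are
  proportional, so they collapse into a single one.\<close>

lemma rep_upto_cases:
  assumes "rep_upto G e f"
  shows "rep_below G e f \<or>
    (\<exists>h c g m. rep_below G e h \<and> g \<in> G \<and> g \<noteq> 0 \<and> m + lead_exps g = e \<and> f = h + term3 c m * g)"
  using assms
proof induction
  case rep_zero
  then show ?case by (simp add: rep.rep_zero)
next
  case (rep_step f g' m' c')
  show ?case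
  proof (cases "m' + lead_exps g' = e")
    case False
    then have t: "rep_below G e (term3 c' m' * g')"
      using rep_step by (intro rep_single) auto
    from rep_step.IH show ?thesis
    proof
      assume "rep_below G e f"
      then show ?thesis using rep_add t by blast
    next
      assume "\<exists>h c g m. rep_below G e h \<and> g \<in> G \<and> g \<noteq> 0 \<and> m + lead_exps g = e \<and> f = h + term3 c m * g"
      then obtain h c g m where "rep_below G e h" "g \<in> G" "g \<noteq> 0" "m + lead_exps g = e"
          "f = h + term3 c m * g" by blast
      then have "rep_below G e (h + term3 c' m' * g')"
          "f + term3 c' m' * g' = (h + term3 c' m' * g') + term3 c m * g"
        using rep_add t by (auto simp: algebra_simps)
      then show ?thesis using \<open>g \<in> G\<close> \<open>g \<noteq> 0\<close> \<open>m + lead_exps g = e\<close> by blast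
    qed
  next
    case True
    from rep_step.IH show ?thesis
    proof
      assume "rep_below G e f"
      then show ?thesis using True rep_step by blast
    next
      assume "\<exists>h c g m. rep_below G e h \<and> g \<in> G \<and> g \<noteq> 0 \<and> m + lead_exps g = e \<and> f = h + term3 c m * g"
      then obtain h c g m where h: "rep_below G e h" and g: "g \<in> G" "g \<noteq> 0" "m + lead_exps g = e"
          and f: "f = h + term3 c m * g" by blast
      \<comment> \<open>Scaling the normalised difference by \<open>b\<close> turns its first part
        into the new summand. The new summand is thereby traded for a multiple of the old
        \<open>g\<close> plus something represented below \<open>e\<close>.\<close>
      define b where "b = c' * lead_coeff3 g'"
      let ?d = "term3 (1 / lead_coeff3 g') m' * g' - term3 (1 / lead_coeff3 g) m * g"
      have "rep_below G e (term3 b 0 * ?d)"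
        by (rule rep_term3_mult[OF rep_diff_same_lead]) (use rep_step g True in auto)
      moreover have "term3 b 0 * ?d = term3 c' m' * g' - term3 (b / lead_coeff3 g) m * g"
        unfolding right_diff_distrib mult.assoc[symmetric] term3_mult
        using rep_step(3) by (simp add: b_def)
      ultimately have "rep_below G e (h + (term3 c' m' * g' - term3 (b / lead_coeff3 g) m * g))"
        using rep_add[OF h] by simp
      moreover have "f + term3 c' m' * g' = (h + (term3 c' m' * g' - term3 (b / lead_coeff3 g) m * g))
          + term3 (c + b / lead_coeff3 g) m * g"
        by (simp add: f term3_add distrib_right)
      ultimately show ?thesis using g by blast
    qed
  qed
qed

text \<open>Descent on the bound \<open>e\<close>. If the representation can be lowered,
  \<open>rep_cases\<close> supplies a smaller bound; otherwise a single summand reaches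
  \<open>e\<close>, nothing cancels it, and \<open>e\<close> is the leading monomial of
  \<open>f\<close>.\<close>

lemma lead_divisible_of_rep:
  assumes "rep_upto G e f" and "f \<noteq> 0"
  shows "\<exists>g\<in>G. g \<noteq> 0 \<and> lead_exps g \<le> lead_exps f"
  using assms(1)
proof (induction e rule: wfp_induct_rule[OF wfp_mono_less])
  case (1 e)
  show ?case
  proof (cases "rep_below G e f")
    case True
    then show ?thesis using rep_cases[OF True] 1 assms(2) by blast
  next
    case False
    then obtain h c g m where h: "rep_below G e h" and g: "g \<in> G" "g \<noteq> 0" "m + lead_exps g = e"
        and f: "f = h + term3 c m * g"
      using rep_upto_cases[OF 1(2)] by blast
    have "c \<noteq> 0" using False h f by auto
    have "lead_exps f = e"
    proof (rule lead_exps_eqI)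
      show "coeff3 f e \<noteq> 0"
        using coeff3_rep[OF h, of e] coeff3_term3_mult_lead[of c m g] g \<open>c \<noteq> 0\<close> f by simp
      show "coeff3 f e' = 0" if "e \<lhd> e'" for e'
        using coeff3_rep[OF h, of e'] that g(3) mono_less_trans f
        by (auto simp: coeff3_term3_mult_above)
    qed
    then show ?thesis using g exps_le_add by metis
  qed
qed

lemma lead_divisible:
  assumes "f \<in> ideal_gen G" and "f \<noteq> 0"
  shows "\<exists>g\<in>G. g \<noteq> 0 \<and> lead_exps g \<le> lead_exps f"
  using rep_cases[OF rep_UNIV_ideal_gen[OF assms(1)]] lead_divisible_of_rep assms(2) by blast

lemma ideal_gen_lead_terms: "ideal_gen (lead_term ` G) = ideal_gen (lead_term ` ideal_gen G)"
proof (rule subset_antisym)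
  show "ideal_gen (lead_term ` G) \<subseteq> ideal_gen (lead_term ` ideal_gen G)"
    by (intro ideal.span_mono image_mono) (auto intro: ideal.span_base)
  show "ideal_gen (lead_term ` ideal_gen G) \<subseteq> ideal_gen (lead_term ` G)"
  proof (rule ideal.span_minimal)
    show "lead_term ` ideal_gen G \<subseteq> ideal_gen (lead_term ` G)"
    proof clarify
      fix f assume f: "f \<in> ideal_gen G"
      show "lead_term f \<in> ideal_gen (lead_term ` G)"
      proof (cases "f = 0")
        case True
        then show ?thesis by (simp add: lead_term_def lead_coeff3_def ideal.span_zero)
      next
        case False
        then obtain g where g: "g \<in> G" "g \<noteq> 0" "lead_exps g \<le> lead_exps f"
          using lead_divisible[OF f] by blast
        then have "lead_term f =
            term3 (lead_coeff3 f / lead_coeff3 g) (lead_exps f - lead_exps g) * lead_term g"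
          by (simp add: lead_term_def term3_mult exps_diff_add)
        then show ?thesis
          using g(1) by (metis ideal.span_base ideal.span_scale imageI)
      qed
    qed
  qed simp
qed

end


section \<open>Buchberger's algorithm\<close>

lemma nat_incseq_subseq:
  fixes s :: "nat \<Rightarrow> nat"
  obtains f where "strict_mono f" "incseq (s \<circ> f)"
proof -
  obtain f where f: "strict_mono f" "monoseq (\<lambda>n. s (f n))"
    using seq_monosub by blast
  show ?thesis
  proof (cases "incseq (s \<circ> f)")
    case False
    then have dec: "s (f n) \<le> s (f m)" if "m \<le> n" for m n
      using f(2) that unfolding monoseq_def incseq_def by auto
    \<comment> \<open>A nonincreasing sequence of naturals is constant from the position of its
      minimum on.\<close>
    define N where "N = arg_min (\<lambda>n. s (f n)) (\<lambda>_. True)"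
    have N: "s (f N) \<le> s (f n)" for n
      unfolding N_def by (rule arg_min_nat_le) simp
    have "strict_mono (\<lambda>n. f (N + n))"
      using f(1) by (simp add: strict_mono_def)
    moreover have "incseq (s \<circ> (\<lambda>n. f (N + n)))"
      unfolding incseq_def using N dec le_trans by (metis comp_apply le_add1)
    ultimately show ?thesis by (rule that)
  qed (use f that in blast)
qed

text \<open>Passing to a subsequence three times makes all three coordinates nondecreasing; its
  first two members then suffice.\<close>

lemma dickson:
  fixes e :: "nat \<Rightarrow> nat \<times> nat \<times> nat"
  shows "\<exists>i j. i < j \<and> e i \<le> e j"
proof -
  obtain f where f: "strict_mono f" "incseq ((\<lambda>n. fst (e n)) \<circ> f)"
    using nat_incseq_subseq by blast
  obtain g where g: "strict_mono g" "incseq ((\<lambda>n. fst (snd (e (f n)))) \<circ> g)"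
    using nat_incseq_subseq by blast
  obtain h where h: "strict_mono h" "incseq ((\<lambda>n. snd (snd (e (f (g n))))) \<circ> h)"
    using nat_incseq_subseq by blast
  let ?k = "\<lambda>n. f (g (h n))"
  have less: "g (h 0) < g (h 1)" "h 0 < h 1" "?k 0 < ?k 1"
    using f(1) g(1) h(1) by (simp_all add: strict_mono_less)
  then have "e (?k 0) \<le> e (?k 1)"
    using incseqD[OF f(2), of "g (h 0)" "g (h 1)"] incseqD[OF g(2), of "h 0" "h 1"]
      incseqD[OF h(2), of 0 1]
    by (simp add: less_eq_prod_def)
  then show ?thesis using less(3) by blast
qed

lemma buchberger_stepE:
  assumes "buchberger_step G G'"
  obtains r where "r \<noteq> 0" "G' = insert r G" "r \<in> ideal_gen G"
    "\<And>g. g \<in> G \<Longrightarrow> g \<noteq> 0 \<Longrightarrow> \<not> lead_exps g \<le> lead_exps r"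
proof -
  from assms obtain f g r where fg: "f \<in> G" "g \<in> G" and r: "remainder_of G (s_poly f g) r" "r \<noteq> 0"
    "G' = insert r G"
    unfolding buchberger_step_def by blast
  have "s_poly f g - (s_poly f g - r) \<in> ideal_gen G"
    using r(1) fg unfolding remainder_of_def
    by (intro ideal.span_diff[OF s_poly_ideal_gen reduces_rtranclp_diff_ideal_gen]) auto
  then have "r \<in> ideal_gen G" by simp
  moreover have "\<not> lead_exps g \<le> lead_exps r" if "g \<in> G" "g \<noteq> 0" for g
    using r(1,2) that unfolding remainder_of_def reduces_def by blast
  ultimately show ?thesis using that r by blast
qed

text \<open>In an infinite run the leading monomial of each new remainder would be divisible by none
  of the earlier ones, against Dickson's lemma.\<close>

lemma buchberger_terminates: "buchberger_terminates F"
  unfolding buchberger_terminates_def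
proof
  assume "\<exists>s. s 0 = F \<and> (\<forall>n. buchberger_step (s n) (s (Suc n)))"
  then obtain s where step: "\<And>n. buchberger_step (s n) (s (Suc n))" by blast
  have "\<exists>r. r \<noteq> 0 \<and> s (Suc n) = insert r (s n) \<and>
      (\<forall>g \<in> s n. g \<noteq> 0 \<longrightarrow> \<not> lead_exps g \<le> lead_exps r)" for n
    using step[of n] by (elim buchberger_stepE) blast
  then obtain r where r: "\<And>n. r n \<noteq> 0" "\<And>n. s (Suc n) = insert (r n) (s n)"
      "\<And>n g. g \<in> s n \<Longrightarrow> g \<noteq> 0 \<Longrightarrow> \<not> lead_exps g \<le> lead_exps (r n)"
    by metis
  have "incseq s" by (rule incseq_SucI) (use r(2) in blast)
  obtain i j where "i < j" "lead_exps (r i) \<le> lead_exps (r j)"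
    using dickson[of "\<lambda>n. lead_exps (r n)"] by blast
  moreover have "r i \<in> s j"
    using \<open>incseq s\<close> \<open>i < j\<close> r(2)[of i] by (metis Suc_leI incseqD insertI1 subsetD)
  ultimately show False using r(1,3) by blast
qed

lemma buchberger_steps_invariants:
  assumes "buchberger_step\<^sup>*\<^sup>* F G"
  shows "ideal_gen G = ideal_gen F" "finite F \<Longrightarrow> finite G"
proof -
  have "ideal_gen G = ideal_gen F \<and> (finite F \<longrightarrow> finite G)"
    using assms
  proof induction
    case (step G G')
    from step.hyps(2) obtain r where "G' = insert r G" "r \<in> ideal_gen G"
      by (elim buchberger_stepE)
    moreover from this have "ideal_gen G' = ideal_gen G"
      unfolding ideal.span_eq by (auto intro: ideal.span_base)
    ultimately show ?case using step.IH by simp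
  qed simp
  then show "ideal_gen G = ideal_gen F" "finite F \<Longrightarrow> finite G" by blast+
qed

text \<open>Every S-polynomial has a remainder, and a set on which no step is possible admits only
  the remainder 0.\<close>

lemma buchberger_closed_output:
  assumes "buchberger_output F G"
  shows "buchberger_closed G"
proof
  fix f g assume fg: "f \<in> G" "g \<in> G" "f \<noteq> 0" "g \<noteq> 0"
  obtain r where r: "remainder_of G (s_poly f g) r" using ex_remainder_of by blast
  then have "r = 0"
    using assms fg unfolding buchberger_output_def buchberger_step_def by blast
  then show "(reduces G)\<^sup>*\<^sup>* (s_poly f g) 0"
    using r unfolding remainder_of_def by blast
qed

lemma groebner_basis_buchberger_output:
  assumes "finite F" and "buchberger_output F G"
  shows "groebner_basis G (ideal_gen F)"
proof -
  have steps: "buchberger_step\<^sup>*\<^sup>* F G"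
    using assms(2) unfolding buchberger_output_def by blast
  interpret buchberger_closed G
    using assms(2) by (rule buchberger_closed_output)
  show ?thesis
    unfolding groebner_basis_def buchberger_steps_invariants(1)[OF steps, symmetric]
    using buchberger_steps_invariants(2)[OF steps assms(1)] ideal_gen_lead_terms
    by (auto intro: ideal.span_base)
qed


section \<open>Elimination\<close>

lemma lambda_part_ideal_gen:
  assumes "p \<in> ideal_gen (lambda_part (ideal_gen F))"
  shows "p \<in> lambda_part (ideal_gen F)"
  using assms
proof (induction rule: ideal.span_induct_alt)
  case base
  show ?case by (simp add: lambda_part_def ideal.span_zero)
next
  case (step c p q)
  have "[:[:c:]:] * [:[:p:]:] + [:[:q:]:] \<in> ideal_gen F"
    using step unfolding lambda_part_def by (intro ideal.span_add ideal.span_scale) auto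
  then show ?case
    by (simp add: lambda_part_def)
qed

lemma mem_ideal_gen_singleton: "p \<in> ideal_gen {q :: 'a::comm_ring_1} \<longleftrightarrow> q dvd p"
  by (auto simp: ideal.span_singleton dvd_def mult.commute)

text \<open>Division with remainder by a nonzero member of least degree. The monic normalisation
  fixes the generator uniquely, which later makes its coefficients real.\<close>

lemma ex_monic_generator:
  fixes J :: "'a::field poly set"
  assumes "ideal_gen J \<subseteq> J"
  obtains p where "J = ideal_gen {p}" "p = 0 \<or> lead_coeff p = 1"
proof (cases "J \<subseteq> {0}")
  case True
  moreover have "0 \<in> J" using assms ideal.span_zero by blast
  ultimately have "J = ideal_gen {0}" by (auto simp: mem_ideal_gen_singleton)
  then show ?thesis using that by blast
next
  case False
  have scale: "c * p \<in> J" if "p \<in> J" for c p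
    using assms that by (meson ideal.span_base ideal.span_scale subsetD)
  have diff: "p - q \<in> J" if "p \<in> J" "q \<in> J" for p q
    using assms that by (meson ideal.span_base ideal.span_diff subsetD)
  obtain q where q: "q \<in> J" "q \<noteq> 0" "\<And>p. p \<in> J \<Longrightarrow> p \<noteq> 0 \<Longrightarrow> degree q \<le> degree p"
    using False exists_least_iff[of "\<lambda>n. \<exists>p\<in>J. p \<noteq> 0 \<and> degree p = n"]
    by (metis insertI1 leI subsetI)
  define p where "p = smult (1 / lead_coeff q) q"
  have p: "p \<in> J" "p \<noteq> 0" "lead_coeff p = 1" "degree p = degree q"
    using scale[of q "[:1 / lead_coeff q:]"] q by (simp_all add: p_def)
  have "p dvd f" if "f \<in> J" for f
  proof -
    have "f mod p \<in> J"
      using diff[OF that scale[OF p(1), of "f div p"]] by (simp add: minus_div_mult_eq_mod)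
    then have "f mod p = 0"
      using q(3)[of "f mod p"] degree_mod_less'[of p f] p(2,4) by fastforce
    then show ?thesis by (simp add: dvd_eq_mod_eq_0)
  qed
  moreover have "f \<in> J" if "p dvd f" for f
    using that scale[OF p(1)] by (metis dvdE mult.commute)
  ultimately have "J = ideal_gen {p}"
    by (auto simp: mem_ideal_gen_singleton)
  then show ?thesis using that p(3) by blast
qed

text \<open>A generator of the elimination ideal has minimal degree, so the basis element whose leading
  monomial divides its leading monomial is associated to it.\<close>

lemma (in buchberger_closed) ideal_gen_lambda_part:
  assumes "lambda_part (ideal_gen G) = ideal_gen {p}"
  shows "ideal_gen (lambda_part G) = ideal_gen {p}"
proof (rule subset_antisym)
  have sub: "lambda_part G \<subseteq> ideal_gen {p}"
    unfolding assms[symmetric] lambda_part_def by (auto intro: ideal.span_base)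
  then show "ideal_gen (lambda_part G) \<subseteq> ideal_gen {p}"
    by (rule ideal.span_minimal) simp
  have "p \<in> ideal_gen (lambda_part G)"
  proof (cases "p = 0")
    case False
    have "[:[:p:]:] \<in> ideal_gen G" "[:[:p:]:] \<noteq> 0"
      using assms ideal.span_base[of p "{p}"] False by (auto simp: lambda_part_def)
    then obtain g where g: "g \<in> G" "g \<noteq> 0" "lead_exps g \<le> lead_exps [:[:p:]:]"
      using lead_divisible by blast
    \<comment> \<open>This is where the elimination order enters: since \<open>x\<close> and
      \<open>y\<close> rank above \<open>\<lambda>\<close>, a leading monomial free of them forces
      all of \<open>g\<close> to be free of them.\<close>
    then have deg: "degree g = 0" "degree (coeff g 0) = 0" "degree (coeff (coeff g 0) 0) \<le> degree p"
      by (auto simp: lead_exps_def less_eq_prod_def)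
    then obtain q where q: "g = [:[:q:]:]"
      by (metis degree_0_id)
    have "q \<in> lambda_part G" "q \<noteq> 0" using g q by (auto simp: lambda_part_def)
    then have "p dvd q" using sub mem_ideal_gen_singleton by blast
    then obtain k where k: "q = p * k" by (rule dvdE)
    then have "degree k = 0" "k \<noteq> 0"
      using deg(3) \<open>q \<noteq> 0\<close> False by (auto simp: q degree_mult_eq)
    then have "q dvd p"
      using k by (metis is_unit_iff_degree mult_unit_dvd_iff dvd_refl)
    then show ?thesis
      using \<open>q \<in> lambda_part G\<close> by (metis dvdE ideal.span_base ideal.span_scale mult.commute)
  qed (simp add: ideal.span_zero)
  then show "ideal_gen {p} \<subseteq> ideal_gen (lambda_part G)"
    by (intro ideal.span_minimal) auto
qed

section \<open>Evaluation and differentiation of the characteristic polynomial\<close>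

lemma (in unital_ring_hom) hom_poly: "h (poly p a) = poly (map_poly h p) (h a)"
  by (induction p) (simp_all add: hom_zero hom_add hom_mult map_poly_pCons)

lemma map_poly_pderiv:
  fixes h :: "'a::idom \<Rightarrow> 'b::idom"
  assumes "unital_ring_hom h"
  shows "map_poly h (pderiv p) = pderiv (map_poly h p)"
proof -
  interpret unital_ring_hom h by (rule assms)
  show ?thesis
    by (rule poly_eqI)
      (simp add: coeff_map_poly coeff_pderiv hom_zero hom_mult hom_add hom_one hom_of_nat)
qed

lemma unital_ring_hom_eval_y_lambda: "unital_ring_hom (\<lambda>q :: complex poly poly. poly (poly q [:b:]) c)"
  by unfold_locales simp_all

text \<open>Evaluating \<open>y\<close> and \<open>\<lambda>\<close> first leaves a univariate
  polynomial in \<open>x\<close>, and this evaluation of coefficients commutes with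
  \<open>pderiv\<close>.\<close>

lemma DERIV_eval3_x:
  "((\<lambda>a. eval3 p c a b) has_field_derivative eval3 (deriv_x p) c a b) (at a)"
proof -
  interpret unital_ring_hom "\<lambda>q :: complex poly poly. poly (poly q [:b:]) c"
    by (rule unital_ring_hom_eval_y_lambda)
  show ?thesis
    by (simp add: eval3_def deriv_x_def hom_poly map_poly_pderiv[OF unital_ring_hom_axioms])
qed

text \<open>Substituting a value for the outer variable commutes with the derivative in the next
  one, provided that the value is constant in the latter.\<close>

lemma pderiv_poly_const:
  fixes p :: "'a::idom poly poly"
  assumes "pderiv k = 0"
  shows "pderiv (poly p k) = poly (map_poly pderiv p) k"
  by (induction p) (simp_all add: map_poly_pCons pderiv_add pderiv_mult assms)

lemma DERIV_eval3_y:
  "((\<lambda>b. eval3 p c a b) has_field_derivative eval3 (deriv_y p) c a b) (at b)"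
proof -
  interpret unital_ring_hom "\<lambda>r :: complex poly. poly r c"
    by (rule unital_ring_hom_poly)
  have "poly (map_poly pderiv p) [:[:a:]:] = pderiv (poly p [:[:a:]:])"
    by (rule pderiv_poly_const[symmetric]) (simp add: pderiv_pCons)
  then show ?thesis
    by (simp add: eval3_def deriv_y_def hom_poly map_poly_pderiv[OF unital_ring_hom_axioms])
qed

lemma DERIV_zero_at_real_minimum:
  assumes deriv: "(F has_field_derivative F') (at (of_real x))"
    and real: "\<And>t :: real. Im (F (of_real t)) = 0"
    and nonneg: "\<And>t :: real. 0 \<le> Re (F (of_real t))"
    and zero: "F (of_real x) = 0"
  shows "F' = 0"
proof -
  have vec: "((\<lambda>t :: real. F (of_real t)) has_vector_derivative F') (at x)"
    using deriv by (rule has_vector_derivative_real_field)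
  have "((\<lambda>t. Re (F (of_real t))) has_real_derivative Re F') (at x)"
    using bounded_linear.has_vector_derivative[OF bounded_linear_Re vec]
    by (simp add: has_real_derivative_iff_has_vector_derivative)
  then have "Re F' = 0"
    by (rule DERIV_local_min[of _ _ _ 1]) (use nonneg zero in auto)
  moreover have "((\<lambda>t. Im (F (of_real t))) has_real_derivative Im F') (at x)"
    using bounded_linear.has_vector_derivative[OF bounded_linear_Im vec]
    by (simp add: has_real_derivative_iff_has_vector_derivative)
  \<comment> \<open>The imaginary part is identically zero on the reals, so it too has a local
    minimum at \<open>x\<close>.\<close>
  then have "Im F' = 0"
    by (rule DERIV_local_min[of _ _ _ 1]) (use real in auto)
  ultimately show ?thesis by (simp add: complex_eq_iff)
qed

section \<open>The polynomial D at real points\<close>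

lemma hermitian_shifted_op_diff:
  "hermitian X \<Longrightarrow> hermitian Y \<Longrightarrow> hermitian (shifted_op X Y x y - c *\<^sub>R mat 1)"
  by (intro hermitian_diff hermitian_scaleR hermitian_mat_1 hermitian_shifted_op)

text \<open>With the entries written out, ring homomorphisms can be pushed through the determinant
  by \<open>hom_det\<close>; this serves evaluation as well as conjugation.\<close>

lemma D_poly_nth:
  fixes X Y :: "complex^'n^'n"
  shows "D_poly X Y = det (\<chi> i j. const3 ((X ** X + Y ** Y) $ i $ j)
     - 2 * (var_x * const3 (X $ i $ j) + var_y * const3 (Y $ i $ j))
     + (if i = j then var_x\<^sup>2 + var_y\<^sup>2 - var_lambda else 0))"
proof -
  have scale: "(mat c ** A) $ i $ j = c * A $ i $ j" for c :: poly3 and A :: "poly3^'n^'n" and i j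
    by (simp add: matrix_matrix_mult_def mat_def if_distrib if_distribR cong: if_cong)
  have mat: "mat c $ i $ j = (if i = j then c else 0)" for c :: poly3 and i j :: 'n
    by (simp add: mat_def)
  show ?thesis
    unfolding D_poly_def
    by (rule arg_cong[of _ _ det]) (simp add: vec_eq_iff scale const_mat_def mat)
qed

lemma eval3_D_poly:
  "eval3 (D_poly X Y) (of_real c) (of_real x) (of_real y) = det (shifted_op X Y x y - c *\<^sub>R mat 1)"
proof -
  interpret unital_ring_hom "\<lambda>p. eval3 p (of_real c) (of_real x) (of_real y)"
    by (rule unital_ring_hom_eval3)
  have vars: "eval3 (const3 a) (of_real c) (of_real x) (of_real y) = a"
    "eval3 var_x (of_real c) (of_real x) (of_real y) = of_real x"
    "eval3 var_y (of_real c) (of_real x) (of_real y) = of_real y"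
    "eval3 var_lambda (of_real c) (of_real x) (of_real y) = of_real c" for a
    by (simp_all add: eval3_def const3_def var_x_def var_y_def var_lambda_def)
  show ?thesis
    unfolding D_poly_nth hom_det
    by (rule arg_cong[of _ _ det])
      (simp add: vec_eq_iff shifted_op_def mat_def hom_add hom_diff hom_mult hom_power hom_numeral
        hom_zero vars scaleR_conv_of_real[where 'a=complex])
qed

lemma common_zero_at_minimum:
  assumes "hermitian X" "hermitian Y"
    and min: "is_min {lambda_min (shifted_op X Y x' y') | x' y'. True} (lambda_min (shifted_op X Y x y))"
  shows "common_zero (system_polys X Y)
    (of_real (lambda_min (shifted_op X Y x y))) (of_real x) (of_real y)"
proof -
  define c where "c = lambda_min (shifted_op X Y x y)"
  let ?F = "\<lambda>x y. eval3 (D_poly X Y) (of_real c) x y"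
  have real: "Im (?F (of_real x') (of_real y')) = 0" for x' y' :: real
    unfolding eval3_D_poly by (intro Im_det_hermitian hermitian_shifted_op_diff assms)
  have nonneg: "0 \<le> Re (?F (of_real x') (of_real y'))" for x' y' :: real
  proof -
    let ?l = "lambda_min (shifted_op X Y x' y')"
    have "psd (shifted_op X Y x' y' - ?l *\<^sub>R mat 1)"
      using assms by (intro lambda_min(2) hermitian_shifted_op)
    moreover have "c \<le> ?l" using min unfolding is_min_def c_def by blast
    ultimately have "psd ((shifted_op X Y x' y' - ?l *\<^sub>R mat 1) + (?l - c) *\<^sub>R mat 1)"
      unfolding psd_iff
      by (auto intro!: hermitian_add hermitian_scaleR hermitian_mat_1
          simp: matrix_vector_mult_add_rdistrib matrix_vector_mult_scaleR_left inner_add_right)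
    then have "psd (shifted_op X Y x' y' - c *\<^sub>R mat 1)"
      by (simp add: scaleR_diff_left)
    then show ?thesis unfolding eval3_D_poly by (rule Re_det_psd_nonneg)
  qed
  have zero: "?F (of_real x) (of_real y) = 0"
    unfolding eval3_D_poly eigenvalue_iff_det[symmetric] c_def
    using assms by (intro lambda_min(1) hermitian_shifted_op)
  have "eval3 (deriv_x (D_poly X Y)) (of_real c) (of_real x) (of_real y) = 0"
    by (rule DERIV_zero_at_real_minimum[OF DERIV_eval3_x]) (use real nonneg zero in auto)
  moreover have "eval3 (deriv_y (D_poly X Y)) (of_real c) (of_real x) (of_real y) = 0"
    by (rule DERIV_zero_at_real_minimum[OF DERIV_eval3_y]) (use real nonneg zero in auto)
  ultimately show ?thesis
    using zero by (simp add: common_zero_def system_polys_def c_def)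
qed

lemma common_zero_ge_lambda_min:
  assumes "hermitian X" "hermitian Y"
    and "common_zero (system_polys X Y) (of_real c) (of_real x) (of_real y)"
  shows "lambda_min (shifted_op X Y x y) \<le> c"
  using assms
  by (intro lambda_min_le hermitian_shifted_op)
    (simp_all add: common_zero_def system_polys_def eval3_D_poly eigenvalue_iff_det)


section \<open>The eliminant\<close>

text \<open>Only the coefficients are conjugated and the variables stay fixed, so this is a ring
  homomorphism, unlike the conjugation of values as a map on polynomials in the same
  variables.\<close>

definition conj3 :: "poly3 \<Rightarrow> poly3" where
  "conj3 = map_poly (map_poly (map_poly cnj))"

lemma unital_ring_hom_cnj: "unital_ring_hom cnj"
  by unfold_locales simp_all

lemmas unital_ring_hom_map_cnj = unital_ring_hom.hom_map_poly[OF unital_ring_hom_cnj]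
lemmas unital_ring_hom_map_map_cnj = unital_ring_hom.hom_map_poly[OF unital_ring_hom_map_cnj]

lemma unital_ring_hom_conj3: "unital_ring_hom conj3"
  unfolding conj3_def by (rule unital_ring_hom.hom_map_poly[OF unital_ring_hom_map_map_cnj])

lemma conj3_deriv_x: "conj3 (deriv_x p) = deriv_x (conj3 p)"
  unfolding conj3_def deriv_x_def
  by (rule map_poly_pderiv[OF unital_ring_hom_map_map_cnj])

lemma conj3_deriv_y: "conj3 (deriv_y p) = deriv_y (conj3 p)"
  unfolding conj3_def deriv_y_def
  by (rule poly_eqI)
    (simp add: coeff_map_poly map_poly_pderiv[OF unital_ring_hom_map_cnj])

text \<open>Conjugating the coefficients transposes the Hermitian matrix under the determinant.\<close>

lemma conj3_D_poly:
  assumes "hermitian X" "hermitian Y"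
  shows "conj3 (D_poly X Y) = D_poly X Y"
proof -
  interpret unital_ring_hom conj3
    by (rule unital_ring_hom_conj3)
  have vars: "conj3 (const3 a) = const3 (cnj a)" "conj3 var_x = var_x" "conj3 var_y = var_y"
    "conj3 var_lambda = var_lambda" for a
    by (simp_all add: conj3_def const3_def var_x_def var_y_def var_lambda_def map_poly_pCons)
  have herm: "hermitian (X ** X + Y ** Y)"
    using assms by (intro hermitian_add hermitian_square)
  show ?thesis
    unfolding D_poly_nth hom_det
    by (subst (2) det_transpose[symmetric], rule arg_cong[of _ _ det])
      (simp add: vec_eq_iff transpose_def hom_add hom_diff hom_mult hom_power hom_numeral hom_zero
        vars hermitian_nth[OF herm] hermitian_nth[OF assms(1)] hermitian_nth[OF assms(2)]
        del: vector_add_component)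
qed

lemma conj3_system_polys:
  assumes "hermitian X" "hermitian Y" and "p \<in> system_polys X Y"
  shows "conj3 p = p"
  using assms(3) by (auto simp: system_polys_def conj3_deriv_x conj3_deriv_y conj3_D_poly[OF assms(1,2)])

text \<open>The ideal is stable under \<open>conj3\<close>, so its monic generator \<open>p\<close>
  divides its own conjugate. Both are monic of the same degree, hence equal, and \<open>p\<close>
  has real coefficients; the zero ideal gives \<open>R = 0\<close>.\<close>

lemma ex_eliminant:
  assumes "\<And>p. p \<in> F \<Longrightarrow> conj3 p = p"
  obtains R where "eliminant F R"
proof -
  obtain p where p: "lambda_part (ideal_gen F) = ideal_gen {p}" "p = 0 \<or> lead_coeff p = 1"
    using ex_monic_generator[of "lambda_part (ideal_gen F)"] lambda_part_ideal_gen by blast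
  have "[:[:p:]:] \<in> ideal_gen F"
    using p(1) ideal.span_base[of p "{p}"] by (auto simp: lambda_part_def)
  then have "conj3 [:[:p:]:] \<in> ideal_gen F"
    by (rule unital_ring_hom.hom_ideal_gen[OF unital_ring_hom_conj3]) (simp add: assms ideal.span_base)
  then have "map_poly cnj p \<in> lambda_part (ideal_gen F)"
    by (simp add: lambda_part_def conj3_def map_poly_pCons)
  then have "p dvd map_poly cnj p"
    unfolding p(1) mem_ideal_gen_singleton .
  then obtain k where k: "map_poly cnj p = p * k" by (rule dvdE)
  have "map_poly cnj p = p"
  proof (cases "p = 0")
    case False
    have deg: "degree (map_poly cnj p) = degree p"
      by (rule degree_map_poly) simp
    then have lead: "lead_coeff (map_poly cnj p) = 1"
      using p(2) False by (simp add: coeff_map_poly)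
    then have "map_poly cnj p \<noteq> 0" by auto
    then have "degree k = 0"
      using k deg by (auto simp: degree_mult_eq)
    moreover have "lead_coeff k = 1"
      using lead p(2) False by (simp only: k lead_coeff_mult) simp
    ultimately have "k = 1"
      by (metis degree_0_id one_pCons)
    then show ?thesis using k by simp
  qed simp
  then have "cnj (coeff p n) = coeff p n" for n
    by (metis coeff_map_poly complex_cnj_zero)
  then have "map_poly complex_of_real (map_poly Re p) = p"
    by (intro poly_eqI) (simp add: coeff_map_poly complex_eq_iff)
  then show ?thesis
    using p(1) that[of "map_poly Re p"] unfolding eliminant_def by simp
qed

text \<open>The eliminant lies in the ideal and so vanishes wherever the generators do. Whether a
  given root extends to a real solution is a separate condition in the set that is
  minimised.\<close>

lemma eliminant_root:
  assumes "eliminant F R" and "common_zero F (of_real c) a b"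
  shows "poly R c = 0"
proof -
  let ?p = "map_poly complex_of_real R"
  have "[:[:?p:]:] \<in> ideal_gen F"
    using assms(1) ideal.span_base[of ?p "{?p}"] by (auto simp: eliminant_def lambda_part_def)
  then have "poly ?p (of_real c) = 0"
    using eval3_ideal_gen[OF assms(2)] by (force simp: eval3_def)
  moreover have "unital_ring_hom complex_of_real"
    by unfold_locales simp_all
  ultimately show ?thesis
    by (simp flip: unital_ring_hom.hom_poly)
qed

theorem mainTheorem2:
  fixes X Y :: "complex^'n^'n"
  assumes "hermitian X" and "hermitian Y"
  shows "(\<exists>m. is_min {variance \<rho> X + variance \<rho> Y | \<rho>. \<rho> \<in> density_matrices} m \<and>
              is_min {lambda_min (shifted_op X Y x y) | x y. True} m) \<and>
         (\<forall>x y. is_min {lambda_min (shifted_op X Y x' y') | x' y'. True}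
                  (lambda_min (shifted_op X Y x y)) \<longrightarrow>
            common_zero (system_polys X Y)
              (of_real (lambda_min (shifted_op X Y x y))) (of_real x) (of_real y)) \<and>
         (\<exists>c x y :: real. common_zero (system_polys X Y) (of_real c) (of_real x) (of_real y)) \<and>
         buchberger_terminates (system_polys X Y) \<and>
         (\<forall>G. buchberger_output (system_polys X Y) G \<longrightarrow>
            groebner_basis G (ideal_gen (system_polys X Y)) \<and>
            (\<forall>c x y. common_zero G c x y \<longleftrightarrow> common_zero (system_polys X Y) c x y)) \<and>
         (\<exists>R :: real poly.
            eliminant (system_polys X Y) R \<and>
            (\<forall>G. buchberger_output (system_polys X Y) G \<longrightarrow>
               ideal_gen (lambda_part G) = ideal_gen {map_poly complex_of_real R}) \<and>
            (\<exists>m. is_min {variance \<rho> X + variance \<rho> Y | \<rho>. \<rho> \<in> density_matrices} m \<and>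
                 is_min {c. poly R c = 0 \<and>
                   (\<exists>x y :: real. common_zero (system_polys X Y)
                      (of_real c) (of_real x) (of_real y))} m))"
proof -
  let ?F = "system_polys X Y"
  obtain m where m: "is_min {variance \<rho> X + variance \<rho> Y | \<rho>. \<rho> \<in> density_matrices} m"
      "is_min {lambda_min (shifted_op X Y x y) | x y. True} m"
    using ex_min_variance_sum[OF assms] by blast
  obtain x0 y0 where xy: "m = lambda_min (shifted_op X Y x0 y0)"
    using m(2) unfolding is_min_def by blast
  have zero_m: "common_zero ?F (of_real m) (of_real x0) (of_real y0)"
    using common_zero_at_minimum[OF assms] m(2) unfolding xy by blast
  obtain R where R: "eliminant ?F R"
    using ex_eliminant[of ?F] conj3_system_polys[OF assms] by blast
  have m_le: "m \<le> c" if "common_zero ?F (of_real c) (of_real x) (of_real y)" for c x y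
  proof -
    have "m \<le> lambda_min (shifted_op X Y x y)"
      using m(2) unfolding is_min_def by blast
    then show ?thesis
      using common_zero_ge_lambda_min[OF assms that] by linarith
  qed
  have min_R: "is_min {c. poly R c = 0 \<and>
      (\<exists>x y :: real. common_zero ?F (of_real c) (of_real x) (of_real y))} m"
    unfolding is_min_def using zero_m eliminant_root[OF R] m_le by blast
  have ideal: "ideal_gen G = ideal_gen ?F" if "buchberger_output ?F G" for G
    using that buchberger_steps_invariants(1) unfolding buchberger_output_def by blast
  have elim: "ideal_gen (lambda_part G) = ideal_gen {map_poly complex_of_real R}"
    if "buchberger_output ?F G" for G
    using R ideal[OF that] unfolding eliminant_def
    by (intro buchberger_closed.ideal_gen_lambda_part buchberger_closed_output[OF that]) simp
  have "finite ?F" by (simp add: system_polys_def)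
  then show ?thesis
    using m zero_m R min_R elim common_zero_at_minimum[OF assms] buchberger_terminates
      groebner_basis_buchberger_output common_zero_cong_ideal_gen[OF ideal]
    by (intro conjI allI impI exI[of _ R]) blast+
qed

end
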